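(* Let $m$ be a focus-focus point, with loxodromic eigenvalue $\lambda=\alpha+\mathrm{i}\omega$ ($\alpha,\omega\neq0$), of a Liouville integrable Hamiltonian system with two degrees of freedom, and let $W(j)$ be the (multivalued) rotation number of the torus with value $j=(j_1,j_2)\neq 0$ of the momentum map $J$, for $j$ near the origin of $\mathbb{R}^2$. Then there is a local diffeomorphism of $\mathbb{R}^2$ near the origin, which is $C^1$ at the origin and $C^\infty$ elsewhere, that maps the level sets of $W$ to the integral curves of the differential equation $\dot\zeta=-\bar\lambda\,\zeta$, where $\mathbb{R}^2$ is identified with $\mathbb{C}$ by $\zeta=j_1+\mathrm{i}j_2$. In particular these curves are spirals determined by the eigenvalue $\lambda$ of the focus-focus point.
   Context: Setting. All objects are $C^\infty$. $(M,\Omega)$ is a four-dimensional symplectic manifold, $H,L$ are commuting functions, $F=(H,L)$ is regular almost everywhere, $m$ is an equilibrium of $H$ with $F(m)=(0,0)$ whose linearization has eigenvalues $\pm\alpha\pm\mathrm{i}\omega$, $\alpha,\omega\ne0$; the component of $F^{-1}(0,0)$ containing $m$ is compact and contains no other critical point of $F$. There are symplectic coordinates near $m$ in which $H=\Phi\circ J$, $L=\Psi\circ J$, where $J=(J_1,J_2)$, $J_1=xp_x+yp_y$, $J_2=xp_y-yp_x$, $\Omega=dx\wedge dp_x+dy\wedge dp_y$, $(\Phi,\Psi)$ is a local diffeomorphism of $\mathbb{R}^2$ at $0$, $\Phi(0)=0$, $\partial_1\Phi(0)=\alpha$, $\partial_2\Phi(0)=\omega$. Hamiltonian vector fields are $\dot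 x=\partial H/\partial p_x$, $\dot p_x=-\partial H/\partial x$, etc. $J$ is extended to a neighbourhood of the singular fibre by $J=(\Phi,\Psi)^{-1}\circ(H,L)$. For $j\neq0$ small, the fibre of $J$ over $j$ near the singular fibre is a regular torus. Known facts, part of the setting: the flow of $J_2$ is $2\pi$-periodic near the singular fibre, so $I_2:=J_2$ is an action; a second action $I_1$ (with $2\pi$-periodic flow, $(I_1,I_2)$ action variables) satisfies $2\pi\mathcal{X}_{I_1}=\tau_1\mathcal{X}_{J_1}+\tau_2\mathcal{X}_{J_2}$ with $$\tau_1(j)=\sigma_1(j)-\mathrm{Re}(\ln\zeta),\qquad \tau_2(j)=\sigma_2(j)+\mathrm{Im}(\ln\zeta),\qquad \zeta=j_1+\mathrm{i}j_2,$$ where $\sigma_1,\sigma_2$ are smooth single-valued functions near the origin. Rotation number: writing $\mathcal{X}_H=\omega_1\mathcal{X}_{I_1}+\omega_2\mathcal{X}_{I_2}$ on the torus over $j$, one sets $W(j)=\omega_2(j)/\omega_1(j)$. It is defined on the punctured neighbourhood of the origin up to the choice of branch of $\ln\zeta$ (different branches differ by integers); a level set of $W$ means a curve along which a continuously continued branch of $W$ is constant. *)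

theory Defs
  imports "HOL-Analysis.Analysis"
begin

section \<open>Differentiability classes in normed spaces\<close>

text \<open>The derivatives are two-sided, so these predicates are meant for open sets. In
  \<open>\<real>\<^sup>n\<close> continuity of all iterated directional derivatives is continuity of all iterated
  partial derivatives. The complex plane is used throughout as the real vector space
  \<open>\<real>\<^sup>2\<close>, so \<^term>\<open>Ck_on k S f\<close> for functions on it is real differentiability.\<close>

primrec Ck_on :: "nat \<Rightarrow> 'a set \<Rightarrow> ('a::real_normed_vector \<Rightarrow> 'b::real_normed_vector) \<Rightarrow> bool"
where
  "Ck_on 0 S f \<longleftrightarrow> continuous_on S f"
| "Ck_on (Suc k) S f \<longleftrightarrow>
     (\<forall>x\<in>S. f differentiable at x) \<and> (\<forall>v. Ck_on k S (\<lambda>x. frechet_derivative f (at x) v))"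

definition smooth_on :: "'a set \<Rightarrow> ('a::real_normed_vector \<Rightarrow> 'b::real_normed_vector) \<Rightarrow> bool"
  where "smooth_on S f \<longleftrightarrow> (\<forall>k. Ck_on k S f)"

definition Ck_diffeo ::
  "nat \<Rightarrow> 'a set \<Rightarrow> 'b set \<Rightarrow> ('a::real_normed_vector \<Rightarrow> 'b::real_normed_vector) \<Rightarrow> ('b \<Rightarrow> 'a) \<Rightarrow> bool"
  where "Ck_diffeo k S T f g \<longleftrightarrow>
    open S \<and> open T \<and> homeomorphism S T f g \<and> Ck_on k S f \<and> Ck_on k T g"

definition smooth_diffeo ::
  "'a set \<Rightarrow> 'b set \<Rightarrow> ('a::real_normed_vector \<Rightarrow> 'b::real_normed_vector) \<Rightarrow> ('b \<Rightarrow> 'a) \<Rightarrow> bool"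
  where "smooth_diffeo S T f g \<longleftrightarrow> (\<forall>k. Ck_diffeo k S T f g)"


section \<open>Four-dimensional symplectic manifolds\<close>

text \<open>A chart is a pair of an open domain and a coordinate map; the values of the coordinate
  map outside the domain are irrelevant. Tangent vectors, vector fields and differential
  forms are represented by their coordinate expressions, one for each chart.\<close>

type_synonym 'm chart = "'m set \<times> ('m \<Rightarrow> real^4)"

definition chart_inv :: "'m chart \<Rightarrow> real^4 \<Rightarrow> 'm"
  where "chart_inv c = inv_into (fst c) (snd c)"

definition is_chart :: "'m::topological_space chart \<Rightarrow> bool"
  where "is_chart c \<longleftrightarrow> open (fst c) \<and> open (snd c ` fst c) \<and>
    homeomorphism (fst c) (snd c ` fst c) (snd c) (chart_inv c)"

definition smooth_transition :: "'m chart \<Rightarrow> 'm chart \<Rightarrow> bool"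
  where "smooth_transition c d \<longleftrightarrow>
    smooth_on (snd c ` (fst c \<inter> fst d)) (snd d \<circ> chart_inv c)"

text \<open>The differential of a function (defined at least near \<open>p\<close>), evaluated on the tangent
  vector at \<open>p\<close> whose components in the chart \<open>c\<close> are \<open>v\<close>.\<close>

definition differential :: "('m \<Rightarrow> real) \<Rightarrow> 'm chart \<Rightarrow> 'm \<Rightarrow> real^4 \<Rightarrow> real"
  where "differential f c p v = frechet_derivative (f \<circ> chart_inv c) (at (snd c p)) v"

definition smooth_fun :: "'m chart set \<Rightarrow> 'm set \<Rightarrow> ('m \<Rightarrow> real) \<Rightarrow> bool"
  where "smooth_fun \<A> S f \<longleftrightarrow> (\<forall>c\<in>\<A>. smooth_on (snd c ` (fst c \<inter> S)) (f \<circ> chart_inv c))"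

definition regular_at :: "'m chart set \<Rightarrow> ('m \<Rightarrow> real) \<Rightarrow> ('m \<Rightarrow> real) \<Rightarrow> 'm \<Rightarrow> bool"
  where "regular_at \<A> f g p \<longleftrightarrow> (\<forall>c\<in>\<A>. p \<in> fst c \<longrightarrow>
    (\<forall>a b. (\<forall>v. a * differential f c p v + b * differential g c p v = 0) \<longrightarrow> a = 0 \<and> b = 0))"

text \<open>The sign convention is \<open>\<Omega>(\<X>\<^sub>f, v) = df(v)\<close>, which for
  \<open>\<Omega> = dx \<and> dp\<^sub>x + dy \<and> dp\<^sub>y\<close> gives
  \<open>\<dot>x = \<partial>f/\<partial>p\<^sub>x\<close>, \<open>\<dot>p\<^sub>x = -\<partial>f/\<partial>x\<close>, etc.\<close>

definition ham_vf ::
  "('m chart \<Rightarrow> 'm \<Rightarrow> real^4 \<Rightarrow> real^4 \<Rightarrow> real) \<Rightarrow> ('m \<Rightarrow> real) \<Rightarrow> 'm chart \<Rightarrow> 'm \<Rightarrow> real^4"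
  where "ham_vf \<Omega> f c p = (THE X. \<forall>v. \<Omega> c p X v = differential f c p v)"

definition has_velocity ::
  "'m::topological_space chart set \<Rightarrow> ('m chart \<Rightarrow> 'm \<Rightarrow> real^4) \<Rightarrow> (real \<Rightarrow> 'm) \<Rightarrow> bool"
  where "has_velocity \<A> X \<gamma> \<longleftrightarrow> continuous_on UNIV \<gamma> \<and>
    (\<forall>t. \<forall>c\<in>\<A>. \<gamma> t \<in> fst c \<longrightarrow> ((\<lambda>s. snd c (\<gamma> s)) has_vector_derivative X c (\<gamma> t)) (at t))"

definition periodic_flow ::
  "'m::topological_space chart set \<Rightarrow> ('m chart \<Rightarrow> 'm \<Rightarrow> real^4) \<Rightarrow> 'm set \<Rightarrow> real \<Rightarrow> bool"
  where "periodic_flow \<A> X S T \<longleftrightarrow> (\<forall>p\<in>S. \<exists>\<gamma>. \<gamma> 0 = p \<and> range \<gamma> \<subseteq> S \<and>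
    has_velocity \<A> X \<gamma> \<and> (\<forall>t. \<gamma> (t + T) = \<gamma> t))"

text \<open>The Hamiltonian flows of \<open>f\<close> and \<open>g\<close> define a free action of the torus
  \<open>(\<real>/2\<pi>\<int>)\<^sup>2\<close> on \<open>S\<close>; \<open>\<Gamma>\<close> is the orbit map of \<open>p\<close>. In particular both flows are
  \<open>2\<pi>\<close>-periodic.\<close>

definition action_variables ::
  "'m::topological_space chart set \<Rightarrow> ('m chart \<Rightarrow> 'm \<Rightarrow> real^4 \<Rightarrow> real^4 \<Rightarrow> real) \<Rightarrow> 'm set
    \<Rightarrow> ('m \<Rightarrow> real) \<Rightarrow> ('m \<Rightarrow> real) \<Rightarrow> bool"
  where "action_variables \<A> \<Omega> S f g \<longleftrightarrow> smooth_fun \<A> S f \<and> smooth_fun \<A> S g \<and>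
    (\<forall>p\<in>S. \<exists>\<Gamma>. \<Gamma> 0 0 = p \<and> (\<forall>s t. \<Gamma> s t \<in> S) \<and>
      (\<forall>t. has_velocity \<A> (ham_vf \<Omega> f) (\<lambda>s. \<Gamma> s t)) \<and>
      (\<forall>s. has_velocity \<A> (ham_vf \<Omega> g) (\<lambda>t. \<Gamma> s t)) \<and>
      (\<forall>s t s' t'. \<Gamma> s t = \<Gamma> s' t' \<longleftrightarrow>
         (s - s') / (2 * pi) \<in> \<int> \<and> (t - t') / (2 * pi) \<in> \<int>))"

text \<open>The manifold is the whole type \<open>'m\<close>.\<close>

locale smooth_manifold4 =
  fixes \<A> :: "'m::{t2_space, second_countable_topology} chart set"
  assumes charts: "c \<in> \<A> \<Longrightarrow> is_chart c"
    and cover: "(\<Union>c\<in>\<A>. fst c) = UNIV"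
    and compatible: "c \<in> \<A> \<Longrightarrow> d \<in> \<A> \<Longrightarrow> smooth_transition c d"
    and maximal: "is_chart c \<Longrightarrow>
      (\<And>d. d \<in> \<A> \<Longrightarrow> smooth_transition c d \<and> smooth_transition d c) \<Longrightarrow> c \<in> \<A>"

text \<open>In \<open>closed\<close>, the left-hand side is \<open>d\<Omega>(u, v, w)\<close> for coordinate vectors \<open>u\<close>, \<open>v\<close>, \<open>w\<close>.\<close>

locale symplectic_manifold4 = smooth_manifold4 \<A>
  for \<A> :: "'m::{t2_space, second_countable_topology} chart set" +
  fixes \<Omega> :: "'m chart \<Rightarrow> 'm \<Rightarrow> real^4 \<Rightarrow> real^4 \<Rightarrow> real"
  assumes bilinear: "c \<in> \<A> \<Longrightarrow> p \<in> fst c \<Longrightarrow> bilinear (\<Omega> c p)"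
    and alternating: "c \<in> \<A> \<Longrightarrow> p \<in> fst c \<Longrightarrow> \<Omega> c p u u = 0"
    and nondegenerate: "c \<in> \<A> \<Longrightarrow> p \<in> fst c \<Longrightarrow> u \<noteq> 0 \<Longrightarrow> \<exists>v. \<Omega> c p u v \<noteq> 0"
    and smooth_form: "c \<in> \<A> \<Longrightarrow> smooth_on (snd c ` fst c) (\<lambda>x. \<Omega> c (chart_inv c x) u v)"
    and change_of_chart: "c \<in> \<A> \<Longrightarrow> d \<in> \<A> \<Longrightarrow> p \<in> fst c \<inter> fst d \<Longrightarrow>
      \<Omega> c p u v = \<Omega> d p (frechet_derivative (snd d \<circ> chart_inv c) (at (snd c p)) u)
                        (frechet_derivative (snd d \<circ> chart_inv c) (at (snd c p)) v)"
    and closed: "c \<in> \<A> \<Longrightarrow> p \<in> fst c \<Longrightarrow>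
      frechet_derivative (\<lambda>x. \<Omega> c (chart_inv c x) v w) (at (snd c p)) u +
      frechet_derivative (\<lambda>x. \<Omega> c (chart_inv c x) w u) (at (snd c p)) v +
      frechet_derivative (\<lambda>x. \<Omega> c (chart_inv c x) u v) (at (snd c p)) w = 0"

locale integrable_system4 = symplectic_manifold4 \<A> \<Omega>
  for \<A> :: "'m::{t2_space, second_countable_topology} chart set" and \<Omega> +
  fixes H L :: "'m \<Rightarrow> real"
  assumes smooth_H: "smooth_fun \<A> UNIV H"
    and smooth_L: "smooth_fun \<A> UNIV L"
    and commute: "c \<in> \<A> \<Longrightarrow> p \<in> fst c \<Longrightarrow> \<Omega> c p (ham_vf \<Omega> H c p) (ham_vf \<Omega> L c p) = 0"
    and regular_ae: "c \<in> \<A> \<Longrightarrow> negligible (snd c ` {p \<in> fst c. \<not> regular_at \<A> H L p})"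


section \<open>Focus-focus points\<close>

definition complex_eigenvalues :: "real^'n^'n \<Rightarrow> complex set"
  where "complex_eigenvalues A =
    {\<mu>. \<exists>v::complex^'n. v \<noteq> 0 \<and> (\<chi> i j. complex_of_real (A $ i $ j)) *v v = \<mu> *s v}"

definition linearization ::
  "('m chart \<Rightarrow> 'm \<Rightarrow> real^4) \<Rightarrow> 'm chart \<Rightarrow> 'm \<Rightarrow> real^4^4"
  where "linearization X c p =
    matrix (frechet_derivative (\<lambda>x. X c (chart_inv c x)) (at (snd c p)))"

text \<open>Coordinates are ordered as \<open>(x, y, p\<^sub>x, p\<^sub>y)\<close>, and the pair \<open>(J\<^sub>1, J\<^sub>2)\<close> is written
  as the complex number \<open>J\<^sub>1 + \<i> J\<^sub>2\<close>.\<close>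

definition std_form :: "real^4 \<Rightarrow> real^4 \<Rightarrow> real"
  where "std_form u v = u$1 * v$3 - u$3 * v$1 + u$2 * v$4 - u$4 * v$2"

definition std_J :: "real^4 \<Rightarrow> complex"
  where "std_J z = Complex (z$1 * z$3 + z$2 * z$4) (z$1 * z$4 - z$2 * z$3)"

text \<open>The extension \<open>J = (\<Phi>, \<Psi>)\<^sup>-\<^sup>1 \<circ> (H, L)\<close>, where \<open>(\<Phi>, \<Psi>)\<close> is inverted on the disc of
  radius \<open>r\<close>.\<close>

definition ext_J ::
  "(complex \<Rightarrow> real) \<Rightarrow> (complex \<Rightarrow> real) \<Rightarrow> real \<Rightarrow> ('m \<Rightarrow> real) \<Rightarrow> ('m \<Rightarrow> real) \<Rightarrow> 'm \<Rightarrow> complex"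
  where "ext_J \<Phi> \<Psi> r H L p = inv_into (ball 0 r) (\<lambda>j. (\<Phi> j, \<Psi> j)) (H p, L p)"

text \<open>\<open>c\<^sub>0\<close> is the symplectic chart of the normal form and \<open>N\<close> is the neighbourhood of the
  singular fibre on which \<open>J\<close> is considered.\<close>

locale focus_focus = integrable_system4 \<A> \<Omega> H L
  for \<A> :: "'m::{t2_space, second_countable_topology} chart set" and \<Omega> and H L +
  fixes m :: 'm and \<alpha> \<omega> :: real
    and c\<^sub>0 :: "'m chart" and \<Phi> \<Psi> :: "complex \<Rightarrow> real" and r :: real and N :: "'m set"
  assumes equilibrium: "c \<in> \<A> \<Longrightarrow> m \<in> fst c \<Longrightarrow> ham_vf \<Omega> H c m = 0"
    and value_m: "H m = 0" "L m = 0"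
    and nonzero: "\<alpha> \<noteq> 0" "\<omega> \<noteq> 0"
    and eigenvalues: "c \<in> \<A> \<Longrightarrow> m \<in> fst c \<Longrightarrow>
      complex_eigenvalues (linearization (ham_vf \<Omega> H) c m) =
        {Complex \<alpha> \<omega>, Complex \<alpha> (- \<omega>), Complex (- \<alpha>) \<omega>, Complex (- \<alpha>) (- \<omega>)}"
    and compact_fibre: "compact (connected_component_set {p. H p = 0 \<and> L p = 0} m)"
    and only_critical: "p \<in> connected_component_set {p. H p = 0 \<and> L p = 0} m \<Longrightarrow> p \<noteq> m \<Longrightarrow>
      regular_at \<A> H L p"
    and chart0: "c\<^sub>0 \<in> \<A>" "m \<in> fst c\<^sub>0" "snd c\<^sub>0 m = 0"
    and darboux: "p \<in> fst c\<^sub>0 \<Longrightarrow> \<Omega> c\<^sub>0 p = std_form"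
    and r_pos: "0 < r"
    and local_diffeo: "\<exists>T g. smooth_diffeo (ball 0 r) T (\<lambda>j. (\<Phi> j, \<Psi> j)) g"
    and Phi_0: "\<Phi> 0 = 0"
    and Phi_deriv: "frechet_derivative \<Phi> (at 0) 1 = \<alpha>" "frechet_derivative \<Phi> (at 0) \<i> = \<omega>"
    and normal_form: "p \<in> fst c\<^sub>0 \<Longrightarrow> std_J (snd c\<^sub>0 p) \<in> ball 0 r \<and>
      H p = \<Phi> (std_J (snd c\<^sub>0 p)) \<and> L p = \<Psi> (std_J (snd c\<^sub>0 p))"
    and nbhd: "open N" "connected_component_set {p. H p = 0 \<and> L p = 0} m \<subseteq> N"
    and range_F: "(\<lambda>p. (H p, L p)) ` N \<subseteq> (\<lambda>j. (\<Phi> j, \<Psi> j)) ` ball 0 r"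
    and torus: "j \<in> ball 0 r - {0} \<Longrightarrow> {p \<in> N. ext_J \<Phi> \<Psi> r H L p = j} homeomorphic
      (sphere (0::complex) 1 \<times> sphere (0::complex) 1)"
    and regular_torus: "p \<in> N \<Longrightarrow> ext_J \<Phi> \<Psi> r H L p \<noteq> 0 \<Longrightarrow>
      regular_at \<A> (Re \<circ> ext_J \<Phi> \<Psi> r H L) (Im \<circ> ext_J \<Phi> \<Psi> r H L) p"


section \<open>Action variables and rotation number\<close>

text \<open>The multivalued quantities on the punctured disc (\<open>I\<^sub>1\<close>, \<open>\<tau>\<^sub>2\<close>, \<open>W\<close>) are functions
  of \<open>l = ln \<zeta>\<close>, i.e. functions on the universal cover. Given \<open>l\<close>, the branch of
  \<open>ln \<zeta>\<close> on the plane slit along the ray opposite to \<open>exp l\<close> which equals \<open>l\<close> at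
  \<open>\<zeta> = exp l\<close> is the following.\<close>

definition ln_branch :: "complex \<Rightarrow> complex \<Rightarrow> complex"
  where "ln_branch l \<zeta> = l + Ln (\<zeta> / exp l)"

definition slit_preimage :: "'m set \<Rightarrow> ('m \<Rightarrow> complex) \<Rightarrow> complex \<Rightarrow> 'm set"
  where "slit_preimage N J l = {p \<in> N. J p / exp l \<notin> \<real>\<^sub>\<le>\<^sub>0}"

definition action_branch :: "(complex \<Rightarrow> real) \<Rightarrow> ('m \<Rightarrow> complex) \<Rightarrow> complex \<Rightarrow> 'm \<Rightarrow> real"
  where "action_branch I\<^sub>1 J l p = I\<^sub>1 (ln_branch l (J p))"

locale focus_focus_actions = focus_focus \<A> \<Omega> H L m \<alpha> \<omega> c\<^sub>0 \<Phi> \<Psi> r N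
  for \<A> :: "'m::{t2_space, second_countable_topology} chart set" and \<Omega> and H L
    and m \<alpha> \<omega> c\<^sub>0 \<Phi> \<Psi> r N +
  fixes I\<^sub>1 :: "complex \<Rightarrow> real" and \<sigma>\<^sub>1 \<sigma>\<^sub>2 :: "complex \<Rightarrow> real"
  assumes sigma_smooth: "smooth_on (ball 0 r) \<sigma>\<^sub>1" "smooth_on (ball 0 r) \<sigma>\<^sub>2"
    and J2_periodic:
      "periodic_flow \<A> (ham_vf \<Omega> (Im \<circ> ext_J \<Phi> \<Psi> r H L)) N (2 * pi)"
    and actions: "exp l \<in> ball 0 r \<Longrightarrow>
      action_variables \<A> \<Omega> (slit_preimage N (ext_J \<Phi> \<Psi> r H L) l)
        (action_branch I\<^sub>1 (ext_J \<Phi> \<Psi> r H L) l) (Im \<circ> ext_J \<Phi> \<Psi> r H L)"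
    and I1_field: "exp l \<in> ball 0 r \<Longrightarrow> c \<in> \<A> \<Longrightarrow>
      p \<in> fst c \<inter> slit_preimage N (ext_J \<Phi> \<Psi> r H L) l \<Longrightarrow> j = ext_J \<Phi> \<Psi> r H L p \<Longrightarrow>
      (2 * pi) *\<^sub>R ham_vf \<Omega> (action_branch I\<^sub>1 (ext_J \<Phi> \<Psi> r H L) l) c p =
        (\<sigma>\<^sub>1 j - Re (ln_branch l j)) *\<^sub>R ham_vf \<Omega> (Re \<circ> ext_J \<Phi> \<Psi> r H L) c p +
        (\<sigma>\<^sub>2 j + Im (ln_branch l j)) *\<^sub>R ham_vf \<Omega> (Im \<circ> ext_J \<Phi> \<Psi> r H L) c p"

text \<open>The branch of \<open>W = \<omega>\<^sub>2/\<omega>\<^sub>1\<close> at \<open>j = exp l\<close> belonging to the value \<open>l\<close> of \<open>ln j\<close>.\<close>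

definition rotation_number ::
  "'m chart set \<Rightarrow> ('m chart \<Rightarrow> 'm \<Rightarrow> real^4 \<Rightarrow> real^4 \<Rightarrow> real) \<Rightarrow> 'm set
    \<Rightarrow> ('m \<Rightarrow> real) \<Rightarrow> ('m \<Rightarrow> complex) \<Rightarrow> (complex \<Rightarrow> real) \<Rightarrow> complex \<Rightarrow> real"
  where "rotation_number \<A> \<Omega> N H J I\<^sub>1 l = (THE w. \<exists>\<omega>\<^sub>1 \<omega>\<^sub>2. w = \<omega>\<^sub>2 / \<omega>\<^sub>1 \<and>
    (\<forall>c\<in>\<A>. \<forall>p\<in>N \<inter> fst c. J p = exp l \<longrightarrow>
      ham_vf \<Omega> H c p =
        \<omega>\<^sub>1 *\<^sub>R ham_vf \<Omega> (action_branch I\<^sub>1 J l) c p + \<omega>\<^sub>2 *\<^sub>R ham_vf \<Omega> (Im \<circ> J) c p))"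


section \<open>Level sets, integral curves and spirals\<close>

text \<open>All points of \<open>D\<close> (a subset of the punctured plane) which can be reached from \<open>p\<close> along
  a curve \<open>exp \<circ> l\<close> in \<open>D\<close> on which the branch of \<open>W\<close> continued along the curve, i.e.
  \<open>W \<circ> l\<close>, is constant.\<close>

definition level_set :: "(complex \<Rightarrow> real) \<Rightarrow> complex set \<Rightarrow> complex \<Rightarrow> complex set"
  where "level_set W D p = {exp (pathfinish l) | l. path l \<and> exp (pathstart l) = p \<and>
    exp ` path_image l \<subseteq> D \<and> (\<forall>z\<in>path_image l. W z = W (pathstart l))}"

text \<open>The maximal integral curve through \<open>q\<close> of the vector field \<open>f\<close> on \<open>D\<close>, as a set.\<close>

definition integral_curve ::
  "('a::real_normed_vector \<Rightarrow> 'a) \<Rightarrow> 'a set \<Rightarrow> 'a \<Rightarrow> 'a set"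
  where "integral_curve f D q = {\<eta> t | \<eta> t. \<eta> (0::real) = q \<and>
    (\<forall>s\<in>closed_segment 0 t. \<eta> s \<in> D \<and>
      (\<eta> has_vector_derivative f (\<eta> s)) (at s within closed_segment 0 t))}"

text \<open>A curve without self-intersections that tends to the origin while its polar angle
  tends to \<open>\<infinity>\<close> or \<open>-\<infinity>\<close>.\<close>

definition is_spiral :: "complex set \<Rightarrow> bool"
  where "is_spiral S \<longleftrightarrow> (\<exists>\<rho> \<theta>. continuous_on {0<..} \<rho> \<and> continuous_on {0<..} \<theta> \<and>
    (\<forall>t>0. \<rho> t > 0) \<and> S = (\<lambda>t::real. rcis (\<rho> t) (\<theta> t)) ` {0<..} \<and>
    inj_on (\<lambda>t. rcis (\<rho> t) (\<theta> t)) {0<..} \<and> (\<rho> \<longlongrightarrow> 0) at_top \<and>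
    (filterlim \<theta> at_top at_top \<or> filterlim \<theta> at_bot at_top))"

end

theory Submission
  imports Defs "HOL-Real_Asymp.Real_Asymp"
begin

text \<open>Put \<open>h = \<partial>\<^sub>2\<Phi> / \<partial>\<^sub>1\<Phi>\<close>, so that \<open>h(0) = \<omega>/\<alpha>\<close>. Comparing coefficients of the Hamiltonian
  vector fields gives, with \<open>l = ln \<zeta>\<close>,
  \<open>-2\<pi>W = h Re l + Im l - h\<sigma>\<^sub>1 + \<sigma>\<^sub>2 = (\<omega>/\<alpha>) Re l + Im l + \<phi>(\<zeta>)\<close>, where
  \<open>\<phi>(\<zeta>) = (h(\<zeta>) - \<omega>/\<alpha>) ln |\<zeta>| - h\<sigma>\<^sub>1 + \<sigma>\<^sub>2\<close> is single-valued. Hence \<open>W\<close> is, up to a factor, the first integral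
  \<open>(\<omega>/\<alpha>) Re ln + Im ln\<close> of \<open>\<zeta>' = -cnj \<lambda> \<zeta>\<close> composed with the twist \<open>G(\<zeta>) = \<zeta> exp(\<i>\<phi>(\<zeta>))\<close>.
  Since \<open>h - \<omega>/\<alpha>\<close> vanishes at \<open>0\<close>, \<open>\<phi>\<close> is continuous at \<open>0\<close> and \<open>|\<zeta>| |D\<phi>|\<close> tends to \<open>0\<close>,
  which makes \<open>G\<close> continuously differentiable at \<open>0\<close>.\<close>

section \<open>Calculus of differentiability classes\<close>

lemma Ck_on_cong:
  assumes "open S" "Ck_on k S f" "\<And>x. x \<in> S \<Longrightarrow> f x = g x"
  shows "Ck_on k S g"
  using assms(2,3)
proof (induction k arbitrary: f g)
  case 0
  then show ?case by (simp cong: continuous_on_cong)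
next
  case (Suc k)
  have der: "(g has_derivative frechet_derivative f (at x)) (at x)" if "x \<in> S" for x
    using Suc.prems that \<open>open S\<close>
    by (auto simp: frechet_derivative_works intro: has_derivative_transform_within_open)
  then have eq: "frechet_derivative f (at x) = frechet_derivative g (at x)" if "x \<in> S" for x
    using frechet_derivative_at that by blast
  have "Ck_on k S (\<lambda>x. frechet_derivative g (at x) v)" for v
    by (rule Suc.IH[of "\<lambda>x. frechet_derivative f (at x) v"]) (use Suc.prems(1) eq in auto)
  then show ?case
    using der by (auto simp: differentiable_def)
qed

text \<open>Lets a derivative be supplied in closed form: by uniqueness it agrees on
  \<open>S\<close> with the one selected by \<open>frechet_derivative\<close>, and openness allows
  the replacement in all further derivatives.\<close>

lemma Ck_on_SucI:
  assumes "open S" "\<And>x. x \<in> S \<Longrightarrow> (f has_derivative f' x) (at x)"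
    and "\<And>v. Ck_on k S (\<lambda>x. f' x v)"
  shows "Ck_on (Suc k) S f"
proof -
  have "f' x = frechet_derivative f (at x)" if "x \<in> S" for x
    using assms(2)[OF that] by (rule frechet_derivative_at)
  then have "Ck_on k S (\<lambda>x. frechet_derivative f (at x) v)" for v
    by (intro Ck_on_cong[OF \<open>open S\<close> assms(3)]) auto
  then show ?thesis
    using assms(2) by (auto simp: differentiable_def)
qed

lemma Ck_on_SucD:
  assumes "Ck_on (Suc k) S f"
  shows "x \<in> S \<Longrightarrow> (f has_derivative frechet_derivative f (at x)) (at x)"
    and "Ck_on k S (\<lambda>x. frechet_derivative f (at x) v)"
  using assms by (auto simp: frechet_derivative_works)

lemma Ck_on_continuous: "Ck_on k S f \<Longrightarrow> continuous_on S f"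
  by (cases k) (auto intro!: continuous_at_imp_continuous_on differentiable_imp_continuous_within)

lemma Ck_on_Suc_imp: "Ck_on (Suc k) S f \<Longrightarrow> Ck_on k S f"
proof (induction k arbitrary: f)
  case 0
  then show ?case using Ck_on_continuous[of "Suc 0" S f] by auto
next
  case (Suc k)
  from Suc.prems have "\<forall>x\<in>S. f differentiable at x" by simp
  then show ?case
    using Suc.IH[OF Ck_on_SucD(2)[OF Suc.prems]] unfolding Ck_on.simps(2) by blast
qed

lemma Ck_on_subset: "Ck_on k S f \<Longrightarrow> T \<subseteq> S \<Longrightarrow> Ck_on k T f"
  by (induction k arbitrary: f) (auto intro: continuous_on_subset)

lemma Ck_on_const [simp]: "Ck_on k S (\<lambda>x. c)"
  by (induction k arbitrary: c) auto

lemma Ck_on_bounded_linear: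
  assumes L: "bounded_linear L" and "open S"
  shows "Ck_on k S f \<Longrightarrow> Ck_on k S (\<lambda>x. L (f x))"
proof (induction k arbitrary: f)
  case 0
  then show ?case using bounded_linear.continuous_on[OF L] by auto
next
  case (Suc k)
  show ?case
    using \<open>open S\<close> bounded_linear.has_derivative[OF L Ck_on_SucD(1)[OF Suc.prems]]
      Suc.IH[OF Ck_on_SucD(2)[OF Suc.prems]]
    by (rule Ck_on_SucI)
qed

lemma Ck_on_add:
  assumes "open S"
  shows "Ck_on k S f \<Longrightarrow> Ck_on k S g \<Longrightarrow> Ck_on k S (\<lambda>x. f x + g x)"
proof (induction k arbitrary: f g)
  case 0
  then show ?case by (auto intro: continuous_on_add)
next
  case (Suc k)
  show ?case
    using \<open>open S\<close> has_derivative_add[OF Ck_on_SucD(1)[OF Suc.prems(1)] Ck_on_SucD(1)[OF Suc.prems(2)]]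
      Suc.IH[OF Ck_on_SucD(2)[OF Suc.prems(1)] Ck_on_SucD(2)[OF Suc.prems(2)]]
    by (rule Ck_on_SucI)
qed

lemma Ck_on_minus: "open S \<Longrightarrow> Ck_on k S f \<Longrightarrow> Ck_on k S (\<lambda>x. - f x)"
  by (rule Ck_on_bounded_linear[OF bounded_linear_minus[OF bounded_linear_ident]])

lemma Ck_on_diff:
  "open S \<Longrightarrow> Ck_on k S f \<Longrightarrow> Ck_on k S g \<Longrightarrow> Ck_on k S (\<lambda>x. f x - g x)"
  using Ck_on_add[OF _ _ Ck_on_minus, of S k f g] by simp

lemma Ck_on_sum:
  assumes "open S" "\<And>i. i \<in> I \<Longrightarrow> Ck_on k S (f i)"
  shows "Ck_on k S (\<lambda>x. \<Sum>i\<in>I. f i x)"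
  using assms(2) by (induction I rule: infinite_finite_induct) (auto intro: Ck_on_add[OF \<open>open S\<close>])

text \<open>Induction through the product rule: each summand of the derivative pairs one factor with
  a derivative of the other, and both are of the lower class. Ring products, scalar multiples and
  inner products become instances.\<close>

lemma Ck_on_bilinear:
  assumes B: "bounded_bilinear B" and "open S"
  shows "Ck_on k S f \<Longrightarrow> Ck_on k S g \<Longrightarrow> Ck_on k S (\<lambda>x. B (f x) (g x))"
proof (induction k arbitrary: f g)
  case 0
  then show ?case using bounded_bilinear.continuous_on[OF B] by auto
next
  case (Suc k)
  show ?case
  proof (rule Ck_on_SucI[OF \<open>open S\<close> bounded_bilinear.FDERIV[OF B]])
    show "Ck_on k S (\<lambda>x. B (f x) (frechet_derivative g (at x) v) + B (frechet_derivative f (at x) v) (g x))" for v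
      using Suc.prems Ck_on_Suc_imp[OF Suc.prems(1)] Ck_on_Suc_imp[OF Suc.prems(2)]
      by (intro Ck_on_add \<open>open S\<close> Suc.IH) auto
  qed (fact Ck_on_SucD(1)[OF Suc.prems(1)] Ck_on_SucD(1)[OF Suc.prems(2)])+
qed

lemmas Ck_on_mult = Ck_on_bilinear[OF bounded_bilinear_mult]
lemmas Ck_on_scaleR = Ck_on_bilinear[OF bounded_bilinear_scaleR]
lemmas Ck_on_inner = Ck_on_bilinear[OF bounded_bilinear_inner]

text \<open>In the chain rule the direction fed to the derivative of \<open>f\<close> varies with
  \<open>x\<close>, whereas \<open>Ck_on\<close> controls derivatives in fixed directions. Expanding
  that direction in an orthonormal basis yields a finite sum of products to which the induction
  hypothesis applies.\<close>

lemma Ck_on_compose: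
  fixes f :: "'b::euclidean_space \<Rightarrow> 'c::real_normed_vector"
  assumes "open S" "g ` S \<subseteq> T"
  shows "Ck_on k T f \<Longrightarrow> Ck_on k S g \<Longrightarrow> Ck_on k S (\<lambda>x. f (g x))"
proof (induction k arbitrary: f)
  case 0
  then show ?case using assms by (auto intro: continuous_on_compose2)
next
  case (Suc k)
  have gT: "g x \<in> T" if "x \<in> S" for x using that assms by auto
  have eq: "frechet_derivative f (at (g x)) u =
      (\<Sum>b\<in>Basis. (u \<bullet> b) *\<^sub>R frechet_derivative f (at (g x)) b)" if "x \<in> S" for x u
  proof -
    interpret linear "frechet_derivative f (at (g x))"
      using Suc.prems(1) gT[OF that] by (auto intro: linear_frechet_derivative)
    have "frechet_derivative f (at (g x)) (\<Sum>b\<in>Basis. (u \<bullet> b) *\<^sub>R b) =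
      (\<Sum>b\<in>Basis. (u \<bullet> b) *\<^sub>R frechet_derivative f (at (g x)) b)"
      by (simp add: sum scaleR)
    then show ?thesis by (simp add: euclidean_representation)
  qed
  show ?case
  proof (rule Ck_on_SucI[OF \<open>open S\<close>])
    show "((\<lambda>x. f (g x)) has_derivative
        (\<lambda>v. \<Sum>b\<in>Basis. (frechet_derivative g (at x) v \<bullet> b) *\<^sub>R frechet_derivative f (at (g x)) b)) (at x)"
      if "x \<in> S" for x
      using has_derivative_compose[OF Ck_on_SucD(1)[OF Suc.prems(2) that]
          Ck_on_SucD(1)[OF Suc.prems(1) gT[OF that]]]
      by (simp add: eq[OF that, symmetric])
    show "Ck_on k S (\<lambda>x. \<Sum>b\<in>Basis. (frechet_derivative g (at x) v \<bullet> b) *\<^sub>R frechet_derivative f (at (g x)) b)" for v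
      using Suc.prems Ck_on_Suc_imp[OF Suc.prems(2)]
      by (intro Ck_on_sum Ck_on_scaleR Ck_on_inner Ck_on_const Suc.IH \<open>open S\<close>) auto
  qed
qed

section \<open>Identity, reciprocal, quotient, logarithm and \<open>cis\<close>\<close>

lemma Ck_on_ident: "Ck_on k S (\<lambda>x. x)"
  by (cases k) auto

lemma Ck_on_inverse_real: "Ck_on k (- {0}) (inverse :: real \<Rightarrow> real)"
proof (induction k)
  case 0
  then show ?case by (auto intro!: continuous_intros)
next
  case (Suc k)
  show ?case
  proof (rule Ck_on_SucI)
    show "(inverse has_derivative (\<lambda>v. - (inverse x * v * inverse x))) (at x)" if "x \<in> - {0}" for x :: real
      using that by (intro has_derivative_inverse') auto
    show "Ck_on k (- {0}) (\<lambda>x :: real. - (inverse x * v * inverse x))" for v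
      by (intro Ck_on_minus Ck_on_mult Ck_on_const Suc.IH) auto
  qed auto
qed

lemma Ck_on_divide:
  fixes f g :: "'a::real_normed_vector \<Rightarrow> real"
  assumes "open S" "Ck_on k S f" "Ck_on k S g" "\<And>x. x \<in> S \<Longrightarrow> g x \<noteq> 0"
  shows "Ck_on k S (\<lambda>x. f x / g x)"
  unfolding divide_inverse using assms
  by (intro Ck_on_mult Ck_on_compose[OF _ _ Ck_on_inverse_real]) auto

lemma Ck_on_ln: "Ck_on k {0<..} (ln :: real \<Rightarrow> real)"
proof (cases k)
  case 0
  then show ?thesis by (auto intro!: continuous_intros)
next
  case (Suc k')
  have "Ck_on (Suc k') {0<..} (ln :: real \<Rightarrow> real)"
  proof (rule Ck_on_SucI)
    show "(ln has_derivative (\<lambda>v. v * inverse x)) (at x)" if "x \<in> {0<..}" for x :: real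
      using that by (auto intro!: derivative_eq_intros simp: divide_inverse)
    show "Ck_on k' {0<..} (\<lambda>x :: real. v * inverse x)" for v
      by (intro Ck_on_mult Ck_on_const Ck_on_subset[OF Ck_on_inverse_real]) auto
  qed auto
  with Suc show ?thesis by simp
qed

lemma Ck_on_cis: "Ck_on k UNIV cis"
proof (induction k)
  case 0
  then show ?case by (auto intro!: continuous_intros)
next
  case (Suc k)
  show ?case
  proof (rule Ck_on_SucI)
    show "(cis has_derivative (\<lambda>v. v *\<^sub>R (\<i> * cis x))) (at x)" for x
      by (auto intro!: derivative_eq_intros)
    show "Ck_on k UNIV (\<lambda>x. v *\<^sub>R (\<i> * cis x))" for v
      by (intro Ck_on_scaleR Ck_on_mult Ck_on_const Suc.IH) auto
  qed auto
qed

section \<open>Regularity of inverse maps between plane domains\<close>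

text \<open>The derivative of the inverse is expressed through the two columns of the Jacobian matrix
  by Cramer's rule.\<close>

lemma complex_cramer:
  assumes "Im (cnj A * B) \<noteq> 0" "v = x *\<^sub>R A + y *\<^sub>R B"
  shows "x = - Im (cnj B * v) / Im (cnj A * B)" "y = Im (cnj A * v) / Im (cnj A * B)"
  using assms by (simp_all add: field_simps)

text \<open>A bootstrap: if \<open>G'\<close> is already C^k, then so are the columns of the
  Jacobian of \<open>G\<close> composed with \<open>G'\<close>, hence also the entries of the
  inverse matrix, which are the partial derivatives of \<open>G'\<close>. The base case is
  continuity of the inverse homeomorphism.\<close>

lemma Ck_on_homeomorphism_inverse:
  fixes G :: "complex \<Rightarrow> complex"
  assumes hom: "homeomorphism S T G G'" and "open S" "open T"
    and diff: "\<And>x. x \<in> S \<Longrightarrow> (G has_derivative D x) (at x)"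
    and det: "\<And>x. x \<in> S \<Longrightarrow> Im (cnj (D x 1) * D x \<i>) \<noteq> 0"
    and "Ck_on k S G"
  shows "Ck_on k T G'"
  using assms(6)
proof (induction k)
  case 0
  then show ?case using hom by (auto simp: homeomorphism_def)
next
  case (Suc k)
  \<comment> \<open>The Jacobian determinant of \<open>G\<close> at \<open>G' y\<close>: for plane
    vectors \<open>A\<close>, \<open>B\<close> the number \<open>Im (cnj A * B)\<close> is the
    determinant with columns \<open>A\<close>, \<open>B\<close>.\<close>
  define E where "E = (\<lambda>y. Im (cnj (D (G' y) 1) * D (G' y) \<i>))"
  have G'S: "G' y \<in> S" and GG': "G (G' y) = y" if "y \<in> T" for y
    using that hom by (auto simp: homeomorphism_def)
  have lin: "bounded_linear (D x)" if "x \<in> S" for x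
    using diff[OF that] by (rule has_derivative_bounded_linear)
  have Deq: "D x v = Re v *\<^sub>R D x 1 + Im v *\<^sub>R D x \<i>" if "x \<in> S" for x v
  proof -
    interpret bounded_linear "D x" by (rule lin[OF that])
    have "D x (Re v *\<^sub>R 1 + Im v *\<^sub>R \<i>) = Re v *\<^sub>R D x 1 + Im v *\<^sub>R D x \<i>"
      by (simp only: add scaleR)
    moreover have "Re v *\<^sub>R 1 + Im v *\<^sub>R \<i> = v" by (simp add: complex_eq_iff)
    ultimately show ?thesis by simp
  qed
  define D' where "D' = (\<lambda>y v. (- Im (cnj (D (G' y) \<i>) * v) / E y) *\<^sub>R 1 + (Im (cnj (D (G' y) 1) * v) / E y) *\<^sub>R \<i>)"
  have Cols: "Ck_on k T (\<lambda>y. D (G' y) v)" for v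
  proof (rule Ck_on_compose[where f = "\<lambda>x. D x v" and T = S])
    show "Ck_on k S (\<lambda>x. D x v)"
      by (rule Ck_on_cong[OF \<open>open S\<close> Ck_on_SucD(2)[OF Suc.prems, of v]])
         (metis diff frechet_derivative_at)
    show "Ck_on k T G'" using Suc.IH Ck_on_Suc_imp[OF Suc.prems] .
  qed (use G'S \<open>open T\<close> in auto)
  have cnj_Cols: "Ck_on k T (\<lambda>y. cnj (D (G' y) v))" for v
    by (rule Ck_on_bounded_linear[OF bounded_linear_cnj \<open>open T\<close> Cols])
  have CE: "Ck_on k T E" unfolding E_def
    by (rule Ck_on_bounded_linear[OF bounded_linear_Im \<open>open T\<close> Ck_on_mult[OF \<open>open T\<close> cnj_Cols Cols]])
  have CI: "Ck_on k T (\<lambda>y. Im (cnj (D (G' y) w) * v))" for w v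
    by (rule Ck_on_bounded_linear[OF bounded_linear_Im \<open>open T\<close> Ck_on_mult[OF \<open>open T\<close> cnj_Cols Ck_on_const]])
  have E0: "E y \<noteq> 0" if "y \<in> T" for y using det G'S[OF that] by (simp add: E_def)
  show ?case
  proof (rule Ck_on_SucI[OF \<open>open T\<close>])
    show "Ck_on k T (\<lambda>y. D' y v)" for v
      unfolding D'_def using E0
      by (intro Ck_on_add Ck_on_scaleR Ck_on_divide Ck_on_minus Ck_on_const CE CI \<open>open T\<close>) auto
    show "(G' has_derivative D' y) (at y)" if "y \<in> T" for y
    \<comment> \<open>The continuity of \<open>G'\<close> and a bounded left inverse of the
      derivative of \<open>G\<close> give differentiability of \<open>G'\<close>; no a priori
      regularity of \<open>G'\<close> enters.\<close>
    proof (rule has_derivative_inverse_basic[OF diff[OF G'S[OF that]] _ _ _ \<open>open T\<close> that GG'])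
      show "bounded_linear (D' y)"
        unfolding D'_def divide_inverse
        by (intro bounded_linear_add bounded_linear_scaleR_const bounded_linear_mult_const
            bounded_linear_minus bounded_linear_compose[OF bounded_linear_Im] bounded_linear_mult_right)
      show "D' y \<circ> D (G' y) = id"
      proof
        fix v
        have "Re v = - Im (cnj (D (G' y) \<i>) * D (G' y) v) / E y \<and> Im v = Im (cnj (D (G' y) 1) * D (G' y) v) / E y"
          using complex_cramer[OF det[OF G'S[OF that]] Deq[OF G'S[OF that], of v]]
          unfolding E_def by blast
        then show "(D' y \<circ> D (G' y)) v = id v"
          unfolding D'_def comp_def by (simp add: complex_eq_iff)
      qed
      show "continuous (at y) G'"
        using hom that \<open>open T\<close> by (auto simp: homeomorphism_def continuous_on_eq_continuous_at)
    qed
  qed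
qed

section \<open>Twist maps of a disc\<close>

lemma smooth_onD: "smooth_on S f \<Longrightarrow> Ck_on k S f"
  by (simp add: smooth_on_def)

text \<open>Provides the linear decay of \<open>g\<close> that beats the logarithm in \<phi>. The
  constant is the operator norm of the derivative plus 1 for the remainder.\<close>

lemma has_derivative_eventually_norm_le:
  fixes g :: "'a::real_normed_vector \<Rightarrow> 'b::real_normed_vector"
  assumes "(g has_derivative g') (at 0)" "g 0 = 0"
  shows "\<exists>M. \<forall>\<^sub>F z in at 0. norm (g z) \<le> M * norm z"
proof -
  have bl: "bounded_linear g'" using assms(1) by (rule has_derivative_bounded_linear)
  have "((\<lambda>z. norm (g (0 + z) - g 0 - g' z) / norm z) \<longlongrightarrow> 0) (at 0)"
    using assms(1) by (simp only: has_derivative_at)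
  then have "\<forall>\<^sub>F z in at 0. norm (g (0 + z) - g 0 - g' z) / norm z < 1"
    by (rule order_tendstoD) simp
  moreover have "norm (g z) \<le> (onorm g' + 1) * norm z"
    if "norm (g (0 + z) - g 0 - g' z) / norm z < 1" "z \<noteq> 0" for z
  proof -
    have "norm (g z - g' z) \<le> norm z"
      using that assms(2) by (simp add: divide_simps)
    moreover have "norm (g' z) \<le> onorm g' * norm z" by (rule onorm[OF bl])
    ultimately show ?thesis
      using norm_triangle_sub[of "g z" "g' z"] by (simp add: algebra_simps)
  qed
  ultimately have "\<forall>\<^sub>F z in at 0. norm (g z) \<le> (onorm g' + 1) * norm z"
    unfolding eventually_at_filter by (blast intro: eventually_mono)
  then show ?thesis ..
qed

lemma tendsto_norm_mult_ln: "((\<lambda>z::'a::real_normed_vector. norm z * ln (norm z)) \<longlongrightarrow> 0) (at 0)"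
proof -
  have "((\<lambda>x::real. x * ln x) \<longlongrightarrow> 0) (at_right 0)"
    by real_asymp
  moreover have "filterlim (norm :: 'a \<Rightarrow> real) (at_right 0) (at 0)"
    by (auto simp: filterlim_at eventually_at_topological intro!: tendsto_eq_intros)
  ultimately show ?thesis by (rule filterlim_compose)
qed

text \<open>Abstracts the phase \<phi> of the proof idea: \<open>g\<close> will be h -
  \<omega>/\<alpha>, and \<open>s\<close> will be
  \<open>\<sigma>\<^sub>2 - h \<sigma>\<^sub>1\<close>. The zero of \<open>g\<close> at the origin
  tames the logarithmic term.\<close>

locale twist =
  fixes g s :: "complex \<Rightarrow> real" and R :: real
  assumes g_smooth: "smooth_on (ball 0 R) g" and s_smooth: "smooth_on (ball 0 R) s"
    and g0: "g 0 = 0" and R_pos: "0 < R"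
begin

definition phi :: "complex \<Rightarrow> real" where
  "phi z = g z * ln (norm z) + s z"

definition G :: "complex \<Rightarrow> complex" where
  "G z = z * cis (phi z)"

text \<open>The derivative of \<open>phi\<close> off the origin. At \<open>z = 0\<close> the
  logarithm and the quotient take default values, which do no harm because \<open>dG\<close>
  multiplies \<open>dphi\<close> by \<open>z\<close>.\<close>

definition dphi :: "complex \<Rightarrow> complex \<Rightarrow> real" where
  "dphi z v = frechet_derivative g (at z) v * ln (norm z) + g z * (z \<bullet> v / (norm z)\<^sup>2)
    + frechet_derivative s (at z) v"

definition dG :: "complex \<Rightarrow> complex \<Rightarrow> complex" where
  "dG z v = v * cis (phi z) + z * (dphi z v *\<^sub>R (\<i> * cis (phi z)))"

section \<open>The twist is smooth off the origin and C^1 at the origin\<close>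

lemma norm_G [simp]: "norm (G z) = norm z"
  by (simp add: G_def norm_mult)

lemma g_der: "z \<in> ball 0 R \<Longrightarrow> (g has_derivative frechet_derivative g (at z)) (at z)"
  using Ck_on_SucD(1)[OF smooth_onD[OF g_smooth]] .

lemma s_der: "z \<in> ball 0 R \<Longrightarrow> (s has_derivative frechet_derivative s (at z)) (at z)"
  using Ck_on_SucD(1)[OF smooth_onD[OF s_smooth]] .

lemma g_der_cont: "continuous_on (ball 0 R) (\<lambda>z. frechet_derivative g (at z) v)"
  using Ck_on_SucD(2)[OF smooth_onD[OF g_smooth], of 0] by simp

lemma s_der_cont: "continuous_on (ball 0 R) (\<lambda>z. frechet_derivative s (at z) v)"
  using Ck_on_SucD(2)[OF smooth_onD[OF s_smooth], of 0] by simp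

lemma g_cont: "continuous_on (ball 0 R) g" and s_cont: "continuous_on (ball 0 R) s"
  using smooth_onD[OF g_smooth, of 0] smooth_onD[OF s_smooth, of 0] by auto

text \<open>The product is dominated by a multiple of |z| |ln |z||, since \<open>g\<close> decays
  linearly.\<close>

lemma g_ln_tendsto: "((\<lambda>z. g z * ln (norm z)) \<longlongrightarrow> 0) (at 0)"
proof -
  obtain M where M: "\<forall>\<^sub>F z in at 0. norm (g z) \<le> M * norm z"
    using has_derivative_eventually_norm_le[OF g_der g0] R_pos by auto
  have "((\<lambda>z::complex. M * \<bar>norm z * ln (norm z)\<bar>) \<longlongrightarrow> 0) (at 0)"
    using tendsto_mult_right_zero[OF tendsto_rabs_zero[OF tendsto_norm_mult_ln]] .
  then show ?thesis
  proof (rule Lim_null_comparison[rotated])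
    show "\<forall>\<^sub>F z in at 0. norm (g z * ln (norm z)) \<le> M * \<bar>norm z * ln (norm z)\<bar>"
      using M by eventually_elim (auto simp: abs_mult mult.assoc[symmetric] intro: mult_right_mono)
  qed
qed

lemma phi_cont_0: "isCont phi 0"
proof -
  have "isCont s 0" using s_cont R_pos by (auto simp: continuous_on_eq_continuous_at)
  then have "((\<lambda>z. g z * ln (norm z) + s z) \<longlongrightarrow> 0 + s 0) (at 0)"
    using g_ln_tendsto by (intro tendsto_add) (auto simp: isCont_def)
  then show ?thesis by (simp add: isCont_def phi_def[abs_def] g0)
qed

lemma phi_cont: "continuous_on (ball 0 R) phi"
proof -
  have "continuous_on (ball 0 R - {0}) phi"
    unfolding phi_def using g_cont s_cont
    by (intro continuous_intros) (auto intro: continuous_on_subset)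
  then have "isCont phi z" if "z \<in> ball 0 R" "z \<noteq> 0" for z
    using that by (simp add: continuous_on_eq_continuous_at open_Diff)
  then show ?thesis
    using phi_cont_0 by (metis continuous_at_imp_continuous_on)
qed

lemma Ck_on_phi: "Ck_on k (ball 0 R - {0}) phi"
proof -
  have op: "open (ball 0 R - {0::complex})" by (simp add: open_Diff)
  \<comment> \<open>Half of ln (z \<bullet> z) replaces ln |z|: the inner product is smooth, so the
    norm need not be differentiated.\<close>
  have "Ck_on k (ball 0 R - {0::complex}) (\<lambda>z. ln (z \<bullet> z))"
    by (rule Ck_on_compose[OF op _ Ck_on_ln Ck_on_inner[OF op Ck_on_ident Ck_on_ident]]) auto
  then have *: "Ck_on k (ball 0 R - {0}) (\<lambda>z. g z * ((1/2) * ln (z \<bullet> z)) + s z)"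
    using Ck_on_subset[OF smooth_onD[OF g_smooth]] Ck_on_subset[OF smooth_onD[OF s_smooth]]
    by (intro Ck_on_add Ck_on_mult op Ck_on_const) auto
  have "ln (z \<bullet> z) = 2 * ln (norm z)" if "z \<noteq> 0" for z :: complex
    using that by (simp add: dot_square_norm ln_realpow)
  then show ?thesis
    by (intro Ck_on_cong[OF op *]) (auto simp: phi_def)
qed

lemma Ck_on_G: "Ck_on k (ball 0 R - {0}) G"
proof -
  have op: "open (ball 0 R - {0::complex})" by (simp add: open_Diff)
  show ?thesis unfolding G_def
    by (intro Ck_on_mult op Ck_on_ident Ck_on_compose[OF op _ Ck_on_cis Ck_on_phi]) auto
qed

text \<open>Off the origin this is the product rule. At the origin the remainder is z (cis (\<phi>
  z) - cis (\<phi> 0)), so continuity of \<phi> suffices although \<phi> itself may fail to be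
  differentiable there.\<close>

lemma G_der: 
  assumes "z \<in> ball 0 R"
  shows "(G has_derivative dG z) (at z)"
proof (cases "z = 0")
  case False
  have "((\<lambda>z. ln (norm z)) has_derivative (\<lambda>v. (v \<bullet> sgn z) / norm z)) (at z)"
    using False by (auto intro!: derivative_eq_intros has_derivative_norm simp: divide_inverse)
  moreover have "(\<lambda>v. (v \<bullet> sgn z) / norm z) = (\<lambda>v. z \<bullet> v / (norm z)\<^sup>2)"
    by (simp add: fun_eq_iff sgn_div_norm inner_commute power2_eq_square divide_inverse)
  ultimately have "((\<lambda>z. ln (norm z)) has_derivative (\<lambda>v. z \<bullet> v / (norm z)\<^sup>2)) (at z)"
    by simp
  from has_derivative_add[OF has_derivative_mult[OF g_der[OF assms] this] s_der[OF assms]]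
  have "(phi has_derivative dphi z) (at z)"
    unfolding phi_def[abs_def] dphi_def[abs_def] by (simp add: add.commute)
  then show ?thesis unfolding G_def dG_def
    by (auto intro!: derivative_eq_intros simp: algebra_simps)
next
  case True
  have "((\<lambda>z. norm (cis (phi z) - cis (phi 0))) \<longlongrightarrow> 0) (at 0)"
    using phi_cont_0 by (auto simp: isCont_def intro!: tendsto_eq_intros)
  then have "((\<lambda>z. norm (G (0 + z) - G 0 - dG 0 z) / norm z) \<longlongrightarrow> 0) (at 0)"
  proof (rule Lim_transform_eventually)
    have "norm (cis (phi z) - cis (phi 0)) = norm (G (0 + z) - G 0 - dG 0 z) / norm z" if "z \<noteq> 0" for z
    proof -
      have "G (0 + z) - G 0 - dG 0 z = z * (cis (phi z) - cis (phi 0))"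
        by (simp add: G_def dG_def algebra_simps)
      then show ?thesis using that by (simp add: norm_mult)
    qed
    then show "\<forall>\<^sub>F z in at 0. norm (cis (phi z) - cis (phi 0)) = norm (G (0 + z) - G 0 - dG 0 z) / norm z"
      by (auto simp: eventually_at_filter)
  qed
  moreover have "bounded_linear (dG 0)"
    by (simp add: dG_def[abs_def] bounded_linear_mult_left)
  ultimately show ?thesis using True by (simp only: has_derivative_at)
qed

text \<open>The derivative of \<phi> can grow like ln |z|, but the factor \<open>z\<close> in
  \<open>dG\<close> compensates: after multiplication by |z| each of the three terms of
  \<open>dphi\<close> tends to 0.\<close>

lemma dG_cont_0: "isCont (\<lambda>z. dG z v) 0"
proof -
  have ball: "0 \<in> ball 0 R" "open (ball 0 R)" using R_pos by auto
  have isg: "isCont (\<lambda>z. frechet_derivative g (at z) v) 0" and iss: "isCont (\<lambda>z. frechet_derivative s (at z) v) 0"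
    and ig: "isCont g 0"
    using g_der_cont s_der_cont g_cont ball by (auto simp: continuous_on_eq_continuous_at)
  have 1: "((\<lambda>z. frechet_derivative g (at z) v * (norm z * ln (norm z))) \<longlongrightarrow> frechet_derivative g (at 0) v * 0) (at 0)"
    using isg by (intro tendsto_mult tendsto_norm_mult_ln) (auto simp: isCont_def)
  have 2: "((\<lambda>z. g z * (z \<bullet> v / norm z)) \<longlongrightarrow> 0) (at 0)"
  proof (rule Lim_null_comparison)
    show "\<forall>\<^sub>F z in at 0. norm (g z * (z \<bullet> v / norm z)) \<le> \<bar>g z\<bar> * norm v"
    proof (rule eventuallyI)
      fix z :: complex
      have "\<bar>z \<bullet> v / norm z\<bar> \<le> norm v"
        using Cauchy_Schwarz_ineq2[of z v] by (simp add: divide_simps mult.commute)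
      then show "norm (g z * (z \<bullet> v / norm z)) \<le> \<bar>g z\<bar> * norm v"
        unfolding real_norm_def abs_mult by (intro mult_left_mono) auto
    qed
    show "((\<lambda>z. \<bar>g z\<bar> * norm v) \<longlongrightarrow> 0) (at 0)"
      using ig g0 by (auto simp: isCont_def intro!: tendsto_eq_intros)
  qed
  have 3: "((\<lambda>z. norm z * frechet_derivative s (at z) v) \<longlongrightarrow> 0 * frechet_derivative s (at 0) v) (at 0)"
    using iss by (intro tendsto_intros) (auto simp: isCont_def intro!: tendsto_eq_intros)
  have "((\<lambda>z. norm z * dphi z v) \<longlongrightarrow> 0) (at 0)"
  proof (rule Lim_transform_eventually)
    show "((\<lambda>z. frechet_derivative g (at z) v * (norm z * ln (norm z)) + g z * (z \<bullet> v / norm z)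
        + norm z * frechet_derivative s (at z) v) \<longlongrightarrow> 0) (at 0)"
      using tendsto_add[OF tendsto_add[OF 1 2] 3] by simp
  qed (auto simp: dphi_def eventually_at_filter field_simps power2_eq_square)
  from tendsto_rabs_zero[OF this]
  have "((\<lambda>z. norm (z * (dphi z v *\<^sub>R (\<i> * cis (phi z))))) \<longlongrightarrow> 0) (at 0)"
    by (simp add: norm_mult abs_mult mult.commute)
  then have "((\<lambda>z. z * (dphi z v *\<^sub>R (\<i> * cis (phi z)))) \<longlongrightarrow> 0) (at 0)"
    by (rule tendsto_norm_zero_cancel)
  moreover have "((\<lambda>z. v * cis (phi z)) \<longlongrightarrow> v * cis (phi 0)) (at 0)"
    using phi_cont_0 by (intro tendsto_intros) (auto simp: isCont_def)
  ultimately have "((\<lambda>z. dG z v) \<longlongrightarrow> v * cis (phi 0) + 0) (at 0)"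
    unfolding dG_def by (intro tendsto_add)
  then show ?thesis by (simp add: isCont_def dG_def)
qed

lemma dG_cont: "continuous_on (ball 0 R) (\<lambda>z. dG z v)"
proof -
  have op: "open (ball 0 R - {0::complex})" by (simp add: open_Diff)
  have "Ck_on 0 (ball 0 R - {0}) (\<lambda>z. frechet_derivative G (at z) v)"
    by (rule Ck_on_SucD(2)[OF Ck_on_G])
  then have "Ck_on 0 (ball 0 R - {0}) (\<lambda>z. dG z v)"
    by (rule Ck_on_cong[OF op]) (metis DiffD1 G_der frechet_derivative_at)
  then have "isCont (\<lambda>z. dG z v) z" if "z \<in> ball 0 R" "z \<noteq> 0" for z
    using that op by (simp add: continuous_on_eq_continuous_at)
  then show ?thesis
    using dG_cont_0 by (metis continuous_at_imp_continuous_on)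
qed

lemma Ck_on_1_G: "Ck_on 1 (ball 0 R) G"
  unfolding One_nat_def by (rule Ck_on_SucI[OF open_ball G_der]) (auto intro: dG_cont)

text \<open>Near the origin \<open>G\<close> is close to the rotation by \<phi>(0). The bound 1/2
  will give injectivity, the nonvanishing determinant the regularity of the inverse.\<close>

lemma dG_near:
  "\<exists>d>0. d \<le> R \<and> (\<forall>z\<in>ball 0 d. (\<forall>v. norm (dG z v - cis (phi 0) * v) \<le> 1/2 * norm v) \<and>
    Im (cnj (dG z 1) * dG z \<i>) \<noteq> 0)"
proof -
  have dG0: "dG 0 v = cis (phi 0) * v" for v by (simp add: dG_def)
  have lim: "((\<lambda>z. dG z v) \<longlongrightarrow> dG 0 v) (nhds 0)" for v
    using dG_cont_0 by (simp add: continuous_at tendsto_nhds_iff isCont_def)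
  \<comment> \<open>The two columns contribute 1/4 each, because |Re v| and |Im v| are at most |v|;
    together they make the bound 1/2.\<close>
  have *: "\<forall>\<^sub>F z in nhds 0. dist (dG z v) (dG 0 v) < 1/4" for v
    using lim[of v] by (rule tendstoD) simp
  have "((\<lambda>z. Im (cnj (dG z 1) * dG z \<i>)) \<longlongrightarrow> Im (cnj (dG 0 1) * dG 0 \<i>)) (nhds 0)"
    by (intro tendsto_intros lim)
  moreover have "Im (cnj (dG 0 1) * dG 0 \<i>) = 1"
    by (simp add: dG0 power2_eq_square[symmetric])
  ultimately have "\<forall>\<^sub>F z in nhds 0. Im (cnj (dG z 1) * dG z \<i>) > 0"
    by (intro order_tendstoD) auto
  moreover have "\<forall>\<^sub>F z in nhds 0. z \<in> ball (0::complex) R"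
    using R_pos by (intro eventually_nhds_in_open) auto
  ultimately have "\<forall>\<^sub>F z in nhds 0. dist (dG z 1) (dG 0 1) < 1/4 \<and> dist (dG z \<i>) (dG 0 \<i>) < 1/4
      \<and> Im (cnj (dG z 1) * dG z \<i>) > 0 \<and> z \<in> ball 0 R"
    using *[of 1] *[of \<i>] by (intro eventually_conj)
  then obtain d where d: "d > 0" and dd: "\<And>z. dist z 0 < d \<Longrightarrow> dist (dG z 1) (dG 0 1) < 1/4 \<and> dist (dG z \<i>) (dG 0 \<i>) < 1/4
      \<and> Im (cnj (dG z 1) * dG z \<i>) > 0 \<and> z \<in> ball 0 R"
    unfolding eventually_nhds_metric by blast
  have "norm (dG z v - cis (phi 0) * v) \<le> 1/2 * norm v" if "z \<in> ball 0 (min d R)" for z v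
  proof -
    interpret bounded_linear "dG z"
      using G_der[of z] that by (auto intro: has_derivative_bounded_linear)
    have "v = Re v *\<^sub>R 1 + Im v *\<^sub>R \<i>" by (simp add: complex_eq_iff)
    then have "dG z v = Re v *\<^sub>R dG z 1 + Im v *\<^sub>R dG z \<i>"
      by (metis add scaleR)
    moreover have "cis (phi 0) * v = Re v *\<^sub>R dG 0 1 + Im v *\<^sub>R dG 0 \<i>"
      by (simp add: dG0 complex_eq_iff algebra_simps)
    ultimately have "dG z v - cis (phi 0) * v = Re v *\<^sub>R (dG z 1 - dG 0 1) + Im v *\<^sub>R (dG z \<i> - dG 0 \<i>)"
      by (simp add: algebra_simps)
    also have "norm \<dots> \<le> \<bar>Re v\<bar> * norm (dG z 1 - dG 0 1) + \<bar>Im v\<bar> * norm (dG z \<i> - dG 0 \<i>)"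
      using norm_triangle_ineq[of "Re v *\<^sub>R (dG z 1 - dG 0 1)" "Im v *\<^sub>R (dG z \<i> - dG 0 \<i>)"] by simp
    also have "\<dots> \<le> norm v * (1/4) + norm v * (1/4)"
      using dd[of z] that abs_Re_le_cmod[of v] abs_Im_le_cmod[of v]
      by (intro add_mono mult_mono) (auto simp: dist_norm)
    finally show ?thesis by simp
  qed
  moreover have "Im (cnj (dG z 1) * dG z \<i>) \<noteq> 0" if "z \<in> ball 0 (min d R)" for z
    using dd[of z] that by auto
  ultimately show ?thesis using d R_pos by (intro exI[of _ "min d R"]) auto
qed

text \<open>The image of a small disc is the same disc because \<^term>\<open>G\<close> preserves the norm, and the image is
  open by invariance of domain.\<close>

lemma twist_diffeo:
  assumes "0 < e"
  shows "\<exists>d G'. 0 < d \<and> d < e \<and> d \<le> R \<and> Ck_diffeo 1 (ball 0 d) (ball 0 d) G G' \<and>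
    smooth_diffeo (ball 0 d - {0}) (ball 0 d - {0}) G G'"
proof -
  obtain d0 where d0: "0 < d0" "d0 \<le> R"
    and near: "\<And>z v. z \<in> ball 0 d0 \<Longrightarrow> norm (dG z v - cis (phi 0) * v) \<le> 1/2 * norm v"
    and det: "\<And>z. z \<in> ball 0 d0 \<Longrightarrow> Im (cnj (dG z 1) * dG z \<i>) \<noteq> 0"
    using dG_near by blast
  have inj: "inj_on G (ball 0 d0)"
  proof (rule inj_onI)
    fix x y assume xy: "x \<in> ball 0 d0" "y \<in> ball 0 d0" "G x = G y"
    \<comment> \<open>\<open>G\<close> minus the rotation is 1/2-Lipschitz while the rotation is an
      isometry, so \<open>G x = G y\<close> forces |x - y| \<le> |x - y| / 2.\<close>
    have "norm ((G x - cis (phi 0) * x) - (G y - cis (phi 0) * y)) \<le> 1/2 * norm (x - y)"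
    proof (rule differentiable_bound[of "ball 0 d0" "\<lambda>z. G z - cis (phi 0) * z" "\<lambda>z v. dG z v - cis (phi 0) * v"])
      fix z :: complex assume z: "z \<in> ball 0 d0"
      then have "(G has_derivative dG z) (at z)" using d0 by (intro G_der) auto
      then show "((\<lambda>z. G z - cis (phi 0) * z) has_derivative (\<lambda>v. dG z v - cis (phi 0) * v)) (at z within ball 0 d0)"
        by (intro derivative_intros) (auto intro: has_derivative_at_withinI)
      show "onorm (\<lambda>v. dG z v - cis (phi 0) * v) \<le> 1/2"
        using near[OF z] by (intro onorm_le) auto
    qed (use xy in auto)
    then have "norm (cis (phi 0) * (y - x)) \<le> 1/2 * norm (x - y)"
      using xy(3) by (simp add: algebra_simps)
    then show "x = y" by (simp add: norm_mult norm_minus_commute)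
  qed
  \<comment> \<open>Taking \<open>d\<close> strictly below \<open>d0\<close> keeps the closed disc
    of radius \<open>d\<close> inside the region of injectivity and continuity.\<close>
  define d where "d = min (d0/2) (e/2)"
  have d: "0 < d" "d < e" "d < d0" "d \<le> R" using d0 assms by (auto simp: d_def min_def)
  have cont: "continuous_on (ball 0 d0) G"
    using Ck_on_continuous[OF Ck_on_1_G] d0 by (auto intro: continuous_on_subset)
  have opG: "open (G ` ball 0 d)"
    using d by (intro invariance_of_domain continuous_on_subset[OF cont] inj_on_subset[OF inj]) auto
  have im: "G ` ball 0 d = ball 0 d"
  proof -
    have "connected (ball (0::complex) d)" by simp
    moreover have "openin (top_of_set (ball 0 d)) (G ` ball 0 d)"
      using opG by (auto intro!: open_subset)
    moreover have "closedin (top_of_set (ball 0 d)) (G ` ball 0 d)"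
    proof -
      have "compact (G ` cball 0 d)"
        using d by (intro compact_continuous_image continuous_on_subset[OF cont]) auto
      then have "closed (G ` cball 0 d)" by (rule compact_imp_closed)
      \<comment> \<open>Preservation of the norm keeps boundary points of the closed disc out of the
        open disc. Hence the image is relatively closed as well as open, and connectedness makes it
        the whole disc.\<close>
      moreover have "G ` ball 0 d = ball 0 d \<inter> G ` cball 0 d" by auto
      ultimately show ?thesis by (metis closedin_closed_Int)
    qed
    ultimately have "G ` ball 0 d = {} \<or> G ` ball 0 d = ball 0 d"
      by (auto simp: connected_clopen)
    then show ?thesis using d by auto
  qed
  obtain G' where hom: "homeomorphism (ball 0 d) (ball 0 d) G G'"
    using invariance_of_domain_homeomorphism[of "ball 0 d" G] d im
      continuous_on_subset[OF cont] inj_on_subset[OF inj] by (metis open_ball subset_ball less_imp_le order_refl)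
  have G0: "G 0 = 0" by (simp add: G_def)
  then have G'0: "G' 0 = 0" using homeomorphism_apply1[OF hom, of 0] d by auto
  have hom': "homeomorphism (ball 0 d - {0}) (ball 0 d - {0}) G G'"
  proof (rule homeomorphism_of_subsets[OF hom])
    show "G ` (ball 0 d - {0}) = ball 0 d - {0}"
    proof -
      have "G z = 0 \<longleftrightarrow> z = 0" for z using norm_G[of z] by (metis norm_eq_zero)
      then have "G ` (ball 0 d - {0}) = G ` ball 0 d - {0}" by auto
      then show ?thesis using im by simp
    qed
  qed auto
  have op: "open (ball 0 d - {0::complex})" by (simp add: open_Diff)
  have "Ck_on 1 (ball 0 d) G'"
    by (rule Ck_on_homeomorphism_inverse[OF hom open_ball open_ball G_der det Ck_on_subset[OF Ck_on_1_G]])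
       (use d in auto)
  moreover have "Ck_on 1 (ball 0 d) G" by (rule Ck_on_subset[OF Ck_on_1_G]) (use d in auto)
  moreover have "Ck_on k (ball 0 d - {0}) G" for k
    by (rule Ck_on_subset[OF Ck_on_G]) (use d in auto)
  moreover have "Ck_on k (ball 0 d - {0}) G'" for k
    by (rule Ck_on_homeomorphism_inverse[OF hom' op op G_der det Ck_on_subset[OF Ck_on_G]])
       (use d in auto)
  ultimately show ?thesis
    using d hom hom' op unfolding smooth_diffeo_def Ck_diffeo_def
    by (intro exI[of _ d] exI[of _ G']) auto
qed

end

section \<open>Level sets and integral curves\<close>

lemma has_vector_derivative_exp_mult:
  fixes a :: complex
  shows "((\<lambda>s. exp (a * of_real s)) has_vector_derivative a * exp (a * of_real s)) (at s within S)"
  using exp_scaleR_has_vector_derivative_right[of a s S]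
  by (simp add: scaleR_conv_of_real mult.commute)

text \<open>The hypothesis on \<open>D\<close> says that an orbit through \<open>q\<close> lying in
  \<open>D\<close> at time \<open>t\<close> lies in \<open>D\<close> at all times between 0 and
  \<open>t\<close>, as \<open>integral_curve\<close> demands.\<close>

lemma integral_curve_linear:
  fixes a q :: complex
  assumes D: "\<And>t s. exp (a * of_real t) * q \<in> D \<Longrightarrow> s \<in> closed_segment 0 t \<Longrightarrow> exp (a * of_real s) * q \<in> D"
  shows "integral_curve (\<lambda>\<zeta>. a * \<zeta>) D q =
    {exp (a * of_real t) * q | t. exp (a * of_real t) * q \<in> D}"
proof (intro equalityI subsetI)
  fix z assume "z \<in> integral_curve (\<lambda>\<zeta>. a * \<zeta>) D q"
  then obtain \<eta> t where z: "z = \<eta> t" and \<eta>0: "\<eta> 0 = q"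
    and \<eta>: "\<And>s. s \<in> closed_segment 0 t \<Longrightarrow> \<eta> s \<in> D \<and>
      (\<eta> has_vector_derivative a * \<eta> s) (at s within closed_segment 0 t)"
    unfolding integral_curve_def by blast
  \<comment> \<open>The integrating factor exp (-a s) turns any solution into a constant, which
    gives uniqueness.\<close>
  have "((\<lambda>s. exp (- a * of_real s) * \<eta> s) has_vector_derivative 0) (at s within closed_segment 0 t)"
    if "s \<in> closed_segment 0 t" for s
    using has_vector_derivative_mult[OF has_vector_derivative_exp_mult[of "- a"] conjunct2[OF \<eta>[OF that]]]
    by (simp add: algebra_simps)
  then obtain c where c: "\<And>s. s \<in> closed_segment 0 t \<Longrightarrow> exp (- a * of_real s) * \<eta> s = c"
    using has_vector_derivative_zero_constant[of "closed_segment 0 t" "\<lambda>s. exp (- a * of_real s) * \<eta> s"] by auto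
  have "exp (- a * of_real t) * \<eta> t = q"
    using c[of 0] c[of t] \<eta>0 by simp
  then have "\<eta> t = exp (a * of_real t) * q"
    by (auto simp: exp_minus field_simps)
  then show "z \<in> {exp (a * of_real t) * q | t. exp (a * of_real t) * q \<in> D}"
    using z \<eta>[of t] by auto
next
  fix z assume "z \<in> {exp (a * of_real t) * q | t. exp (a * of_real t) * q \<in> D}"
  then obtain t where z: "z = exp (a * of_real t) * q" and t: "exp (a * of_real t) * q \<in> D"
    by blast
  have "((\<lambda>s. exp (a * of_real s) * q) has_vector_derivative a * (exp (a * of_real s) * q))
    (at s within closed_segment 0 t)" for s
    using has_vector_derivative_mult_left[OF has_vector_derivative_exp_mult] by (simp add: mult.assoc)
  then show "z \<in> integral_curve (\<lambda>\<zeta>. a * \<zeta>) D q"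
    unfolding integral_curve_def using z D[OF t]
    by (intro CollectI exI[of _ "\<lambda>s. exp (a * of_real s) * q"] exI[of _ t]) auto
qed

text \<open>The modulus exp (Re a s) |q| is monotone in \<open>s\<close>, so on the time segment it
  is bounded by its larger end value.\<close>

lemma exp_mult_in_ball:
  fixes a q :: complex
  assumes "exp (a * of_real t) * q \<in> ball 0 d - {0}" "q \<in> ball 0 d" "s \<in> closed_segment 0 t"
  shows "exp (a * of_real s) * q \<in> ball 0 d - {0}"
proof -
  obtain u where u: "0 \<le> u" "u \<le> 1" "s = u * t"
    using assms(3) by (auto simp: closed_segment_def)
  have "Re a * s \<le> max 0 (Re a * t)"
  proof (cases "Re a * t \<le> 0")
    case True
    then show ?thesis using u mult_nonneg_nonpos[of u "Re a * t"] by (simp add: mult.left_commute)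
  next
    case False
    then show ?thesis using u mult_right_mono[of u 1 "Re a * t"] by (simp add: mult.left_commute)
  qed
  then have "exp (Re a * s) * norm q \<le> exp (max 0 (Re a * t)) * norm q"
    by (intro mult_right_mono) auto
  also have "\<dots> = max (norm q) (exp (Re a * t) * norm q)"
    by (auto simp: max_def mult_le_cancel_right1 mult_le_cancel_right2)
  also have "\<dots> < d"
    using assms by (simp add: norm_mult)
  finally show ?thesis using assms(1) by (simp add: norm_mult)
qed

lemma integral_curve_disc:
  fixes a q :: complex
  assumes "q \<in> ball 0 d - {0}"
  shows "integral_curve (\<lambda>\<zeta>. a * \<zeta>) (ball 0 d - {0}) q =
    {exp (a * of_real t) * q | t. exp (a * of_real t) * q \<in> ball 0 d}"
proof -
  have "integral_curve (\<lambda>\<zeta>. a * \<zeta>) (ball 0 d - {0}) q =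
    {exp (a * of_real t) * q | t. exp (a * of_real t) * q \<in> ball 0 d - {0}}"
    by (rule integral_curve_linear, rule exp_mult_in_ball) (use assms in auto)
  then show ?thesis using assms by simp
qed

text \<open>Isolates the plane geometry from the symplectic part. \<open>W\<close> lives on the
  logarithmic cover; multiplying the first integral by \<alpha> avoids a quotient, and the nonzero
  factor \<open>c\<close> leaves level sets unchanged.\<close>

locale twisted_levels =
  fixes \<phi> :: "complex \<Rightarrow> real" and G G' :: "complex \<Rightarrow> complex" and W :: "complex \<Rightarrow> real"
    and \<alpha> \<omega> c d :: real
  assumes d: "0 < d" and \<alpha>: "\<alpha> \<noteq> 0" and \<omega>: "\<omega> \<noteq> 0" and c: "c \<noteq> 0"
    and \<phi>_cont: "continuous_on (ball 0 d) \<phi>"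
    and G_eq: "\<And>z. G z = z * cis (\<phi> z)"
    and hom: "homeomorphism (ball 0 d) (ball 0 d) G G'"
    and W_eq: "\<And>l. exp l \<in> ball 0 d \<Longrightarrow> W l = c * (\<omega> * Re l + \<alpha> * Im l + \<alpha> * \<phi> (exp l))"
begin

section \<open>Level sets of \<open>W\<close> lifted to the logarithmic cover\<close>

abbreviation a :: complex where "a \<equiv> - cnj (Complex \<alpha> \<omega>)"

lemma norm_G: "norm (G z) = norm z"
  by (simp add: G_eq norm_mult)

lemma G'_ball: "z \<in> ball 0 d \<Longrightarrow> G' z \<in> ball 0 d" and GG': "z \<in> ball 0 d \<Longrightarrow> G (G' z) = z"
  and G'G: "z \<in> ball 0 d \<Longrightarrow> G' (G z) = z" and G_ball: "z \<in> ball 0 d \<Longrightarrow> G z \<in> ball 0 d"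
  using hom by (auto simp: homeomorphism_def)

lemma G'_cont: "continuous_on (ball 0 d) G'"
  using hom by (simp add: homeomorphism_def)

lemma norm_G': "z \<in> ball 0 d \<Longrightarrow> norm (G' z) = norm z"
  using norm_G[of "G' z"] GG' by simp

lemma G'_eq: 
  assumes "z \<in> ball 0 d"
  shows "G' z = z * cis (- \<phi> (G' z))"
proof -
  have "z * cis (- \<phi> (G' z)) = G' z * (cis (\<phi> (G' z)) * cis (- \<phi> (G' z)))"
    using GG'[OF assms] by (simp add: G_eq mult.assoc del: cis_mult)
  then show ?thesis by (simp add: cis_mult)
qed

lemma G_exp: "G (exp z) = exp (z + \<i> * \<phi> (exp z))"
  by (simp add: G_eq exp_add cis_conv_exp)

lemma exp_a: "exp (a * of_real t) = rcis (exp (- \<alpha> * t)) (\<omega> * t)"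
  by (simp add: exp_eq_polar rcis_def)

text \<open>On the universal cover a level set of \<open>W\<close> is, after adding \<open>\<i> \<phi>\<close>, a line parallel to \<open>a\<close>.\<close>

lemma level_set_eq:
  assumes p: "p \<in> ball 0 d - {0}"
  shows "G ` level_set W (ball 0 d - {0}) p =
    {exp (a * of_real t) * G p | t. exp (a * of_real t) * G p \<in> ball 0 d}"
proof (intro equalityI subsetI)
  fix w assume "w \<in> G ` level_set W (ball 0 d - {0}) p"
  then obtain l where w: "w = G (exp (pathfinish l))" and l: "exp (pathstart l) = p"
    "exp ` path_image l \<subseteq> ball 0 d - {0}" "\<forall>z\<in>path_image l. W z = W (pathstart l)"
    unfolding level_set_def by blast
  define z0 z1 where "z0 = pathstart l" and "z1 = pathfinish l"
  have z: "exp z0 = p" "exp z1 \<in> ball 0 d" "W z1 = W z0"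
    using l pathfinish_in_path_image[of l] unfolding z0_def z1_def by blast+
  \<comment> \<open>The displacement between the two end points after the lifted twist.\<close>
  define x where "x = (z1 + \<i> * \<phi> (exp z1)) - (z0 + \<i> * \<phi> (exp z0))"
  have "c * (\<omega> * Re z1 + \<alpha> * Im z1 + \<alpha> * \<phi> (exp z1)) =
      c * (\<omega> * Re z0 + \<alpha> * Im z0 + \<alpha> * \<phi> (exp z0))"
    using W_eq[OF z(2)] W_eq[of z0] z p by simp
  then have "\<omega> * Re x + \<alpha> * Im x = 0"
    unfolding mult_cancel_left using c by (simp add: x_def algebra_simps)
  \<comment> \<open>Since \<open>a\<close> is -\<alpha> + i\<omega>, the equation \<omega> Re x +
    \<alpha> Im x = 0 describes the real line spanned by \<open>a\<close>; comparing real parts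
    gives the time.\<close>
  then have x: "x = a * of_real (- Re x / \<alpha>)"
    using \<alpha> by (auto simp: complex_eq_iff field_simps)
  have "w = exp x * G p"
    using w z by (simp add: G_exp z1_def[symmetric] x_def exp_diff exp_add flip: z(1))
  then have "w = exp (a * of_real (- Re x / \<alpha>)) * G p" by (simp only: x[symmetric])
  moreover have "w \<in> ball 0 d" using w z G_ball by (simp only: z1_def)
  ultimately show "w \<in> {exp (a * of_real t) * G p | t. exp (a * of_real t) * G p \<in> ball 0 d}"
    by blast
next
  fix w assume "w \<in> {exp (a * of_real t) * G p | t. exp (a * of_real t) * G p \<in> ball 0 d}"
  then obtain t where w: "w = exp (a * of_real t) * G p" and t: "exp (a * of_real t) * G p \<in> ball 0 d"
    by blast
  have Gp: "G p \<in> ball 0 d" "G p \<noteq> 0" using p G_ball norm_G[of p] by auto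
  \<comment> \<open>The line \<open>v\<close> lifts the orbit of \<open>G p\<close>, and
    \<open>l\<close> lifts its image under \<open>G'\<close>. Subtracting i\<phi> at the point
    \<open>G' (exp (v s))\<close> undoes the twist, by \<open>G'_eq\<close>.\<close>
  define v where "v = (\<lambda>s. Ln (G p) + a * of_real (s * t))"
  define l where "l = (\<lambda>s::real. v s - \<i> * \<phi> (G' (exp (v s))))"
  have ev: "exp (v s) = exp (a * of_real (s * t)) * G p" for s
    unfolding v_def exp_add using Gp by simp
  have vD: "exp (v s) \<in> ball 0 d - {0}" if "s \<in> {0..1}" for s
    unfolding ev
  proof (rule exp_mult_in_ball[of _ t])
    show "s * t \<in> closed_segment 0 t"
      using that by (auto simp: closed_segment_def intro!: exI[of _ s])
  qed (use t Gp in auto)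
  have el: "exp (l s) = G' (exp (v s))" if "s \<in> {0..1}" for s
  proof -
    have "exp (l s) = exp (v s) * cis (- \<phi> (G' (exp (v s))))"
      by (simp add: l_def exp_diff cis_conv_exp exp_minus divide_inverse)
    also have "\<dots> = G' (exp (v s))"
      using vD[OF that] by (intro G'_eq[symmetric]) blast
    finally show ?thesis .
  qed
  have "path l"
  proof -
    have v: "continuous_on {0..1} v" unfolding v_def by (intro continuous_intros)
    have G'v: "continuous_on {0..1} (\<lambda>s. G' (exp (v s)))"
      by (rule continuous_on_compose2[OF G'_cont continuous_on_exp[OF v]]) (use vD in blast)
    have "continuous_on {0..1} (\<lambda>s. \<phi> (G' (exp (v s))))"
      by (rule continuous_on_compose2[OF \<phi>_cont G'v]) (use vD G'_ball in blast)
    with v show ?thesis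
      unfolding path_def l_def by (intro continuous_intros)
  qed
  moreover have "exp (pathstart l) = p"
    using el[of 0] G'G p by (simp add: pathstart_def ev)
  moreover have lD: "exp ` path_image l \<subseteq> ball 0 d - {0}"
  proof -
    have "exp (l s) \<in> ball 0 d" if "s \<in> {0..1}" for s
      unfolding el[OF that] using G'_ball vD[OF that] by blast
    then show ?thesis unfolding path_image_def by auto
  qed
  \<comment> \<open>The two \<phi> terms cancel, and \<omega> Re + \<alpha> Im vanishes in the
    direction \<open>a\<close>, so the value at the start of \<open>v\<close> remains.\<close>
  moreover have "W z = W (pathstart l)" if "z \<in> path_image l" for z
  proof -
    have "W (l s) = c * (\<omega> * Re (Ln (G p)) + \<alpha> * Im (Ln (G p)))" if "s \<in> {0..1}" for s
    proof -
      have "exp (l s) \<in> ball 0 d" using lD that unfolding path_image_def by blast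
      from W_eq[OF this]
      have "W (l s) = c * (\<omega> * Re (l s) + \<alpha> * Im (l s) + \<alpha> * \<phi> (G' (exp (v s))))"
        unfolding el[OF that] .
      then show ?thesis by (simp add: l_def v_def algebra_simps)
    qed
    then show ?thesis using that by (auto simp: path_image_def pathstart_def)
  qed
  ultimately have "exp (pathfinish l) \<in> level_set W (ball 0 d - {0}) p"
    unfolding level_set_def by blast
  moreover have "w = G (exp (pathfinish l))"
    using el[of 1] vD[of 1] GG' w by (simp add: pathfinish_def ev)
  ultimately show "w \<in> G ` level_set W (ball 0 d - {0}) p" by blast
qed

lemma level_set_subset: "level_set W (ball 0 d - {0}) p \<subseteq> ball 0 d"
  unfolding level_set_def using pathfinish_in_path_image by blast

text \<open>The parameter is \<open>s = -ln(|\<zeta>|/d) / |\<alpha>|\<close>, which tends to infinity at the origin.\<close>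

lemma is_spiral_level_set:
  assumes p: "p \<in> ball 0 d - {0}"
  shows "is_spiral (level_set W (ball 0 d - {0}) p)"
proof -
  have Gp: "norm (G p) > 0" "norm (G p) < d" using p norm_G[of p] by auto
  \<comment> \<open>At time \<open>t0\<close> the full orbit through \<open>G p\<close> crosses the
    circle of radius \<open>d\<close>. The factor sgn \<alpha> in \<open>t\<close> orients time
    inwards, so \<open>s > 0\<close> is exactly the part inside the disc.\<close>
  define t0 where "t0 = ln (norm (G p) / d) / \<alpha>"
  define t where "t = (\<lambda>s. t0 + sgn \<alpha> * s)"
  define z where "z = (\<lambda>s. exp (a * of_real (t s)) * G p)"
  define \<rho> where "\<rho> = (\<lambda>s::real. d * exp (- \<bar>\<alpha>\<bar> * s))"
  define \<theta> where "\<theta> = (\<lambda>s. Arg (G p) + \<omega> * t s - \<phi> (G' (z s)))"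
  have sgn: "\<alpha> * sgn \<alpha> = \<bar>\<alpha>\<bar>" by (simp add: abs_sgn)
  have norm_z: "norm (z s) = \<rho> s" for s
  proof -
    have "norm (z s) = exp (- (\<alpha> * t s)) * norm (G p)" by (simp add: z_def norm_mult)
    also have "- (\<alpha> * t s) = - ln (norm (G p) / d) - \<bar>\<alpha>\<bar> * s"
      using \<alpha> by (simp add: t_def t0_def algebra_simps flip: sgn)
    also have "exp \<dots> * norm (G p) = \<rho> s"
      using Gp d by (simp add: \<rho>_def exp_diff exp_minus field_simps)
    finally show ?thesis .
  qed
  have \<rho>: "0 < \<rho> s" for s using d by (simp add: \<rho>_def)
  have \<rho>_less: "\<rho> s < d \<longleftrightarrow> 0 < s" for s
    using d \<alpha> by (simp add: \<rho>_def zero_less_mult_iff)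
  have z_ball: "z s \<in> ball 0 d \<longleftrightarrow> 0 < s" for s
    using norm_z \<rho>_less by simp
  have G'z: "G' (z s) = rcis (\<rho> s) (\<theta> s)" if "0 < s" for s
  proof -
    have zs: "z s = rcis (\<rho> s) (Arg (G p) + \<omega> * t s)"
    proof -
      have "z s = rcis (exp (- \<alpha> * t s)) (\<omega> * t s) * rcis (norm (G p)) (Arg (G p))"
        unfolding z_def exp_a rcis_cmod_Arg ..
      also have "\<dots> = rcis (exp (- \<alpha> * t s) * norm (G p)) (Arg (G p) + \<omega> * t s)"
        by (simp add: rcis_mult add.commute)
      also have "exp (- \<alpha> * t s) * norm (G p) = \<rho> s"
        by (simp add: norm_z[symmetric] z_def norm_mult)
      finally show ?thesis .
    qed
    have "G' (z s) = z s * cis (- \<phi> (G' (z s)))"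
      using z_ball that by (intro G'_eq) blast
    also have "\<dots> = rcis (\<rho> s) (Arg (G p) + \<omega> * t s) * cis (- \<phi> (G' (z s)))"
      by (simp only: zs[symmetric])
    also have "\<dots> = rcis (\<rho> s) (\<theta> s)"
      by (simp add: \<theta>_def rcis_def cis_mult mult.assoc)
    finally show ?thesis .
  qed
  have level: "level_set W (ball 0 d - {0}) p = (\<lambda>s. rcis (\<rho> s) (\<theta> s)) ` {0<..}"
  proof -
    have "level_set W (ball 0 d - {0}) p = G' ` G ` level_set W (ball 0 d - {0}) p"
      using level_set_subset[of p] G'G by (force simp: image_image)
    also have "G ` level_set W (ball 0 d - {0}) p = z ` {0<..}"
    proof -
      define f where "f = (\<lambda>u. exp (a * of_real u) * G p)"
      \<comment> \<open>The change of parameter is onto the line, so no part of the orbit is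
        lost.\<close>
      have "u = t (sgn \<alpha> * (u - t0))" for u
        using \<alpha> by (simp add: t_def sgn_if)
      then have "range t = UNIV" by (rule surjI[OF sym])
      moreover have "z = f \<circ> t" by (simp add: fun_eq_iff f_def z_def)
      ultimately have "range f = range z" by (metis image_comp)
      moreover have "{f u | u. f u \<in> ball 0 d} = range f \<inter> ball 0 d" by blast
      moreover have "range z \<inter> ball 0 d = z ` {s. z s \<in> ball 0 d}" by blast
      moreover have "{s. z s \<in> ball 0 d} = {0<..}" by (simp only: z_ball greaterThan_def)
      ultimately show ?thesis unfolding level_set_eq[OF p] f_def by (simp only:)
    qed
    also have "G' ` z ` {0<..} = (\<lambda>s. rcis (\<rho> s) (\<theta> s)) ` {0<..}"
      using G'z by (force simp: image_image)
    finally show ?thesis .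
  qed
  have z_cont: "continuous_on UNIV z" and t_cont: "continuous_on UNIV t"
    unfolding z_def t_def by (intro continuous_intros)+
  have G'z_cont: "continuous_on {0<..} (\<lambda>s. G' (z s))"
  proof (rule continuous_on_compose2[OF G'_cont])
    show "continuous_on {0<..} z" using z_cont by (rule continuous_on_subset) simp
    show "z ` {0<..} \<subseteq> ball 0 d" using z_ball by blast
  qed
  have "continuous_on {0<..} (\<lambda>s. \<phi> (G' (z s)))"
    by (rule continuous_on_compose2[OF \<phi>_cont G'z_cont]) (use z_ball G'_ball in blast)
  then have \<theta>_cont: "continuous_on {0<..} \<theta>"
    unfolding \<theta>_def using t_cont by (intro continuous_intros) (auto intro: continuous_on_subset)
  have \<rho>_lim: "(\<rho> \<longlongrightarrow> 0) at_top"
  proof -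
    have "filterlim (\<lambda>s. - \<bar>\<alpha>\<bar> * s) at_bot at_top"
      using \<alpha> by (intro filterlim_tendsto_neg_mult_at_bot[OF tendsto_const _ filterlim_ident]) auto
    then have "((\<lambda>s. exp (- \<bar>\<alpha>\<bar> * s)) \<longlongrightarrow> 0) at_top"
      by (rule filterlim_compose[OF exp_at_bot])
    then show ?thesis unfolding \<rho>_def by (rule tendsto_mult_right_zero)
  qed
  have "((\<lambda>s. norm (G' (z s))) \<longlongrightarrow> 0) at_top"
    using \<rho>_lim
  proof (rule Lim_transform_eventually)
    have "\<rho> s = norm (G' (z s))" if "0 < s" for s
      using norm_G'[OF z_ball[THEN iffD2, OF that]] norm_z by simp
    then show "\<forall>\<^sub>F s in at_top. \<rho> s = norm (G' (z s))"
      by (rule eventually_mono[OF eventually_gt_at_top[of 0]])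
  qed
  then have "((\<lambda>s. G' (z s)) \<longlongrightarrow> 0) at_top" by (rule tendsto_norm_zero_cancel)
  moreover have "isCont \<phi> 0" using \<phi>_cont d by (auto simp: continuous_on_eq_continuous_at)
  ultimately have \<phi>_lim: "((\<lambda>s. Arg (G p) + \<omega> * t0 - \<phi> (G' (z s))) \<longlongrightarrow> Arg (G p) + \<omega> * t0 - \<phi> 0) at_top"
    by (intro tendsto_intros isCont_tendsto_compose[of 0 \<phi>])
  \<comment> \<open>The angle is a convergent part plus a linear part of nonzero slope; the slope
    decides the direction of winding.\<close>
  have \<theta>_eq: "\<theta> = (\<lambda>s. (Arg (G p) + \<omega> * t0 - \<phi> (G' (z s))) + (\<omega> * sgn \<alpha>) * s)"
    by (auto simp: \<theta>_def t_def algebra_simps)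
  have "filterlim \<theta> at_top at_top \<or> filterlim \<theta> at_bot at_top"
  proof (cases "\<omega> * sgn \<alpha> > 0")
    case True
    then have "filterlim (\<lambda>s::real. (\<omega> * sgn \<alpha>) * s) at_top at_top"
      by (intro filterlim_tendsto_pos_mult_at_top[OF tendsto_const _ filterlim_ident])
    then show ?thesis unfolding \<theta>_eq using filterlim_tendsto_add_at_top[OF \<phi>_lim] by blast
  next
    case False
    then have "\<omega> * sgn \<alpha> < 0" using \<alpha> \<omega> by (metis linorder_neqE_linordered_idom mult_eq_0_iff sgn_0_0)
    then have "filterlim (\<lambda>s::real. (\<omega> * sgn \<alpha>) * s) at_bot at_top"
      by (intro filterlim_tendsto_neg_mult_at_bot[OF tendsto_const _ filterlim_ident])
    then show ?thesis unfolding \<theta>_eq using filterlim_tendsto_add_at_bot_iff[OF \<phi>_lim] by blast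
  qed
  moreover have "inj_on (\<lambda>s. rcis (\<rho> s) (\<theta> s)) {0<..}"
  proof (rule inj_onI)
    fix x y assume "rcis (\<rho> x) (\<theta> x) = rcis (\<rho> y) (\<theta> y)"
    \<comment> \<open>Self-intersections are excluded by the modulus alone, which is strictly
      decreasing.\<close>
    then have "\<rho> x = \<rho> y" using \<rho> by (metis complex_mod_rcis abs_of_pos)
    then show "x = y" using d \<alpha> by (simp add: \<rho>_def)
  qed
  moreover have "continuous_on {0<..} \<rho>" unfolding \<rho>_def by (intro continuous_intros)
  ultimately show ?thesis
    unfolding is_spiral_def using level \<rho> \<theta>_cont \<rho>_lim
    by (intro exI[of _ \<rho>] exI[of _ \<theta>]) auto
qed

end

section \<open>The rotation number\<close>

context symplectic_manifold4
begin

text \<open>Nondegeneracy gives the uniqueness required by the description operator in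
  \<open>ham_vf\<close>.\<close>

lemma ham_vf_eqI:
  assumes "c \<in> \<A>" "p \<in> fst c" "\<And>v. \<Omega> c p X v = differential f c p v"
  shows "ham_vf \<Omega> f c p = X"
  unfolding ham_vf_def
proof (rule the_equality)
  fix Y assume Y: "\<forall>v. \<Omega> c p Y v = differential f c p v"
  interpret bilinear: linear "\<lambda>u. \<Omega> c p u v" for v
    using bilinear[OF assms(1,2)] by (simp add: bilinear_def)
  have "\<Omega> c p (Y - X) v = 0" for v
    using Y assms(3) by (simp add: bilinear.diff)
  then show "Y = X" using nondegenerate[OF assms(1,2), of "Y - X"] by auto
qed (use assms in auto)

text \<open>Existence by dimension count: contraction with the form is injective, hence surjective
  onto the dual. Linearity has to be assumed because \<open>differential\<close> has an unspecified
  value where \<open>f\<close> is not differentiable.\<close>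

lemma ham_vf_works:
  assumes c: "c \<in> \<A>" "p \<in> fst c" and lin: "linear (differential f c p)"
  shows "\<Omega> c p (ham_vf \<Omega> f c p) v = differential f c p v"
proof -
  interpret l: linear "\<lambda>u. \<Omega> c p u v" for v
    using bilinear[OF c] by (simp add: bilinear_def)
  interpret r: linear "\<Omega> c p u" for u
    using bilinear[OF c] by (simp add: bilinear_def)
  interpret f: linear "differential f c p" by (rule lin)
  have r_eq: "\<Omega> c p u v = (\<Sum>b\<in>Basis. (v \<bullet> b) * \<Omega> c p u b)" for u v
    using r.sum[of u "\<lambda>b. (v \<bullet> b) *\<^sub>R b" Basis] by (simp add: euclidean_representation r.scaleR)
  have f_eq: "differential f c p v = (\<Sum>b\<in>Basis. (v \<bullet> b) * differential f c p b)" for v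
    using f.sum[of "\<lambda>b. (v \<bullet> b) *\<^sub>R b" Basis] by (simp add: euclidean_representation f.scaleR)
  \<comment> \<open>\<open>T u\<close> represents the functional \<Omega>(u, -) by the Euclidean
    inner product, so that the contraction becomes an endomorphism.\<close>
  define T where "T = (\<lambda>u. \<Sum>b\<in>Basis. \<Omega> c p u b *\<^sub>R b)"
  have T: "T u \<bullet> b = \<Omega> c p u b" if "b \<in> Basis" for u b
    using that by (simp add: T_def inner_sum_left inner_Basis if_distrib sum.delta cong: if_cong)
  have "linear T"
    by (rule linearI) (simp_all add: T_def l.add l.scaleR scaleR_add_left sum.distrib scaleR_sum_right)
  moreover have "inj T"
  proof -
    have "u = 0" if "T u = 0" for u
    proof -
      have "\<Omega> c p u v = 0" for v
        unfolding r_eq[of u v] using T[of _ u] that by (intro sum.neutral) auto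
      then show ?thesis using nondegenerate[OF c, of u] by blast
    qed
    then show ?thesis using \<open>linear T\<close> by (simp add: linear_injective_0)
  qed
  ultimately have "surj T" by (simp add: linear_injective_imp_surjective)
  then obtain X where X: "T X = (\<Sum>b\<in>Basis. differential f c p b *\<^sub>R b)" by (metis surjD)
  have "\<Omega> c p X b = differential f c p b" if "b \<in> Basis" for b
    using T[OF that, of X] that unfolding X
    by (simp add: inner_sum_left inner_Basis if_distrib sum.delta cong: if_cong)
  then have "\<Omega> c p X v = differential f c p v" for v
    unfolding r_eq[of X v] f_eq[of v] by simp
  then show ?thesis using ham_vf_eqI[OF c, of X f] by simp
qed

end

lemma complex_linear_split:
  fixes f :: "complex \<Rightarrow> real"
  assumes "linear f"
  shows "f v = f 1 * Re v + f \<i> * Im v"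
proof -
  interpret linear f by (rule assms)
  have "f (Re v *\<^sub>R 1 + Im v *\<^sub>R \<i>) = f 1 * Re v + f \<i> * Im v"
    by (simp only: add scaleR real_scaleR_def mult.commute)
  moreover have "Re v *\<^sub>R 1 + Im v *\<^sub>R \<i> = v" by (simp add: complex_eq_iff)
  ultimately show ?thesis by simp
qed

section \<open>The extended map \<open>J\<close> in charts and the fields it generates\<close>

context focus_focus
begin

abbreviation J :: "'m \<Rightarrow> complex" where "J \<equiv> ext_J \<Phi> \<Psi> r H L"
abbreviation dPhi1 :: "complex \<Rightarrow> real" where "dPhi1 j \<equiv> frechet_derivative \<Phi> (at j) 1"
abbreviation dPhi2 :: "complex \<Rightarrow> real" where "dPhi2 j \<equiv> frechet_derivative \<Phi> (at j) \<i>"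

lemma Phi_smooth: "smooth_on (ball 0 r) \<Phi>"
proof -
  obtain T g where "smooth_diffeo (ball 0 r) T (\<lambda>j. (\<Phi> j, \<Psi> j)) g" using local_diffeo by blast
  then have "Ck_on k (ball 0 r) (\<lambda>j. (\<Phi> j, \<Psi> j))" for k
    by (simp add: smooth_diffeo_def Ck_diffeo_def)
  then have "Ck_on k (ball 0 r) (\<lambda>j. fst (\<Phi> j, \<Psi> j))" for k
    by (intro Ck_on_bounded_linear[OF bounded_linear_fst]) auto
  then show ?thesis by (simp add: smooth_on_def)
qed

lemma J_in: "p \<in> N \<Longrightarrow> J p \<in> ball 0 r"
  and Phi_J: "p \<in> N \<Longrightarrow> \<Phi> (J p) = H p"
proof -
  assume "p \<in> N"
  then have *: "(H p, L p) \<in> (\<lambda>j. (\<Phi> j, \<Psi> j)) ` ball 0 r" using range_F by blast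
  show "J p \<in> ball 0 r" unfolding ext_J_def by (rule inv_into_into[OF *])
  show "\<Phi> (J p) = H p" using f_inv_into_f[OF *] unfolding ext_J_def by simp
qed

lemma open_chart_N:
  assumes "c \<in> \<A>"
  shows "open (snd c ` fst c \<inter> chart_inv c -` N)"
proof -
  have "continuous_on (snd c ` fst c) (chart_inv c)" "open (snd c ` fst c)"
    using charts[OF assms] by (auto simp: is_chart_def homeomorphism_def)
  then show ?thesis using nbhd(1) by (intro continuous_open_preimage)
qed

lemma chart_inv_chart: "c \<in> \<A> \<Longrightarrow> p \<in> fst c \<Longrightarrow> chart_inv c (snd c p) = p"
  using charts by (auto simp: is_chart_def homeomorphism_def)

text \<open>On \<open>N\<close>, \<open>J\<close> is the smooth inverse of (\<Phi>, \<Psi>) composed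
  with (H, L); \<open>inv_into\<close> agrees with that inverse by injectivity on the disc.\<close>

lemma J_has_derivative:
  assumes c: "c \<in> \<A>" "p \<in> N \<inter> fst c"
  shows "((J \<circ> chart_inv c) has_derivative frechet_derivative (J \<circ> chart_inv c) (at (snd c p))) (at (snd c p))"
proof -
  let ?x = "snd c p"
  let ?S = "snd c ` fst c \<inter> chart_inv c -` N"
  have x: "?x \<in> ?S" "chart_inv c ?x = p" using c chart_inv_chart by auto
  obtain T g where g: "smooth_diffeo (ball 0 r) T (\<lambda>j. (\<Phi> j, \<Psi> j)) g" using local_diffeo by blast
  then have hom: "homeomorphism (ball 0 r) T (\<lambda>j. (\<Phi> j, \<Psi> j)) g" and g1: "Ck_on (Suc 0) T g"
    by (auto simp: smooth_diffeo_def Ck_diffeo_def)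
  have inj: "inj_on (\<lambda>j. (\<Phi> j, \<Psi> j)) (ball 0 r)"
    using hom by (auto simp: homeomorphism_def intro: inj_on_inverseI)
  have FT: "(H q, L q) \<in> T" and Jg: "g (H q, L q) = J q" if q: "q \<in> N" for q
  proof -
    obtain j where j: "j \<in> ball 0 r" "(H q, L q) = (\<Phi> j, \<Psi> j)" using range_F q by blast
    then show "(H q, L q) \<in> T" using hom by (auto simp: homeomorphism_def)
    have "J q = j" unfolding ext_J_def j(2) by (rule inv_into_f_f[OF inj j(1)])
    then show "g (H q, L q) = J q" using j homeomorphism_apply1[OF hom j(1)] by simp
  qed
  have "Ck_on (Suc 0) (snd c ` fst c) (H \<circ> chart_inv c)" "Ck_on (Suc 0) (snd c ` fst c) (L \<circ> chart_inv c)"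
    using smooth_H smooth_L c by (auto simp: smooth_fun_def smooth_on_def simp del: Ck_on.simps)
  then have "(H \<circ> chart_inv c) differentiable at ?x" "(L \<circ> chart_inv c) differentiable at ?x"
    using c by auto
  then obtain D1 where "((\<lambda>y. ((H \<circ> chart_inv c) y, (L \<circ> chart_inv c) y)) has_derivative D1) (at ?x)"
    unfolding differentiable_def by (blast intro: has_derivative_Pair)
  moreover have "g differentiable at ((H \<circ> chart_inv c) ?x, (L \<circ> chart_inv c) ?x)"
    using g1 FT c x by auto
  then obtain D2 where "(g has_derivative D2) (at ((H \<circ> chart_inv c) ?x, (L \<circ> chart_inv c) ?x))"
    unfolding differentiable_def by blast
  ultimately obtain D where "((\<lambda>y. g ((H \<circ> chart_inv c) y, (L \<circ> chart_inv c) y)) has_derivative D) (at ?x)"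
    using has_derivative_compose by blast
  then have "((J \<circ> chart_inv c) has_derivative D) (at ?x)"
    by (rule has_derivative_transform_within_open[OF _ open_chart_N[OF c(1)] x(1)]) (simp add: Jg)
  then have "(J \<circ> chart_inv c) differentiable at ?x"
    unfolding differentiable_def by blast
  then show ?thesis by (simp add: frechet_derivative_works)
qed

lemma differential_Re_J: "c \<in> \<A> \<Longrightarrow> p \<in> N \<inter> fst c \<Longrightarrow>
    differential (Re \<circ> J) c p = (\<lambda>v. Re (frechet_derivative (J \<circ> chart_inv c) (at (snd c p)) v))"
  and differential_Im_J: "c \<in> \<A> \<Longrightarrow> p \<in> N \<inter> fst c \<Longrightarrow>
    differential (Im \<circ> J) c p = (\<lambda>v. Im (frechet_derivative (J \<circ> chart_inv c) (at (snd c p)) v))"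
  using frechet_derivative_at[OF has_derivative_Re[OF J_has_derivative]]
    frechet_derivative_at[OF has_derivative_Im[OF J_has_derivative]]
  unfolding differential_def[abs_def] by (simp_all add: comp_def)

lemma linear_differential_J:
  assumes "c \<in> \<A>" "p \<in> N \<inter> fst c"
  shows "linear (differential (Re \<circ> J) c p)" "linear (differential (Im \<circ> J) c p)"
proof -
  interpret linear "frechet_derivative (J \<circ> chart_inv c) (at (snd c p))"
    using J_has_derivative[OF assms] by (auto intro: has_derivative_linear)
  show "linear (differential (Re \<circ> J) c p)" "linear (differential (Im \<circ> J) c p)"
    using assms by (auto simp: differential_Re_J differential_Im_J add scaleR intro!: linearI)
qed

text \<open>The chain rule for H = \<Phi> \<circ> J, valid on all of \<open>N\<close> and not merely
  in the normal form chart.\<close>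

lemma differential_H:
  assumes c: "c \<in> \<A>" "p \<in> N \<inter> fst c"
  shows "differential H c p v = dPhi1 (J p) * differential (Re \<circ> J) c p v + dPhi2 (J p) * differential (Im \<circ> J) c p v"
proof -
  let ?x = "snd c p"
  let ?S = "snd c ` fst c \<inter> chart_inv c -` N"
  let ?D = "frechet_derivative (J \<circ> chart_inv c) (at ?x)"
  have x: "?x \<in> ?S" "chart_inv c ?x = p" using c chart_inv_chart by auto
  have Phi: "(\<Phi> has_derivative frechet_derivative \<Phi> (at (J p))) (at ((J \<circ> chart_inv c) ?x))"
    using Ck_on_SucD(1)[OF smooth_onD[OF Phi_smooth] J_in] c x by simp
  have "((\<lambda>y. \<Phi> ((J \<circ> chart_inv c) y)) has_derivative (\<lambda>v. frechet_derivative \<Phi> (at (J p)) (?D v))) (at ?x)"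
    by (rule has_derivative_compose[OF J_has_derivative[OF c] Phi])
  then have "((H \<circ> chart_inv c) has_derivative (\<lambda>v. frechet_derivative \<Phi> (at (J p)) (?D v))) (at ?x)"
    by (rule has_derivative_transform_within_open[OF _ open_chart_N[OF c(1)] x(1)]) (simp add: Phi_J)
  then have "differential H c p v = frechet_derivative \<Phi> (at (J p)) (?D v)"
    unfolding differential_def by (metis frechet_derivative_at)
  also have "\<dots> = dPhi1 (J p) * Re (?D v) + dPhi2 (J p) * Im (?D v)"
    using Phi by (intro complex_linear_split has_derivative_linear)
  finally show ?thesis using c by (simp add: differential_Re_J differential_Im_J)
qed

lemma ham_vf_H:
  assumes c: "c \<in> \<A>" "p \<in> N \<inter> fst c"
  shows "ham_vf \<Omega> H c p = dPhi1 (J p) *\<^sub>R ham_vf \<Omega> (Re \<circ> J) c p + dPhi2 (J p) *\<^sub>R ham_vf \<Omega> (Im \<circ> J) c p"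
proof (rule ham_vf_eqI)
  have c': "p \<in> fst c" using c by simp
  interpret linear "\<lambda>u. \<Omega> c p u v" for v
    using bilinear[OF c(1) c'] by (simp add: bilinear_def)
  show "\<Omega> c p (dPhi1 (J p) *\<^sub>R ham_vf \<Omega> (Re \<circ> J) c p + dPhi2 (J p) *\<^sub>R ham_vf \<Omega> (Im \<circ> J) c p) v
    = differential H c p v" for v
    by (simp add: add scaleR differential_H[OF c] ham_vf_works[OF c(1) c'] linear_differential_J[OF c])
qed (use c in auto)

text \<open>Contraction with the form turns a relation between the fields into one between the
  differentials of \<open>J\<close>, which \<open>regular_torus\<close> excludes.\<close>

lemma ham_vf_J_independent:
  assumes c: "c \<in> \<A>" "p \<in> N \<inter> fst c" and "J p \<noteq> 0"
    and eq: "s *\<^sub>R ham_vf \<Omega> (Re \<circ> J) c p + t *\<^sub>R ham_vf \<Omega> (Im \<circ> J) c p = 0"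
  shows "s = 0" "t = 0"
proof -
  have c': "p \<in> fst c" using c by simp
  interpret linear "\<lambda>u. \<Omega> c p u v" for v
    using bilinear[OF c(1) c'] by (simp add: bilinear_def)
  have dJ: "s * differential (Re \<circ> J) c p v + t * differential (Im \<circ> J) c p v = 0" for v
    using arg_cong[OF eq, of "\<lambda>u. \<Omega> c p u v"]
    by (simp add: add scaleR zero ham_vf_works[OF c(1) c'] linear_differential_J[OF c])
  have "regular_at \<A> (Re \<circ> J) (Im \<circ> J) p"
    using regular_torus[OF _ assms(3)] c(2) by blast
  then have "(\<forall>v. s * differential (Re \<circ> J) c p v + t * differential (Im \<circ> J) c p v = 0) \<longrightarrow> s = 0 \<and> t = 0"
    unfolding regular_at_def using c(1) c' by blast
  then show "s = 0" "t = 0" using dJ by blast+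
qed

text \<open>A fibre homeomorphic to a torus has a point. Without one the condition defining the
  rotation number would hold vacuously and determine nothing.\<close>

lemma fibre_nonempty:
  assumes "j \<in> ball 0 r - {0}"
  obtains p where "p \<in> N" "J p = j"
proof -
  have "{p \<in> N. J p = j} \<noteq> {}"
  proof
    assume "{p \<in> N. J p = j} = {}"
    with torus[OF assms] have "({} :: 'm set) homeomorphic (sphere (0::complex) 1 \<times> sphere (0::complex) 1)"
      by (simp only:)
    then have "sphere (0::complex) 1 \<times> sphere (0::complex) 1 = {}"
      by (simp only: homeomorphic_empty)
    then show False by simp
  qed
  then show ?thesis using that by blast
qed

end

section \<open>Comparison of coefficients on a regular torus\<close>

context focus_focus_actions
begin

text \<open>Both the Hamiltonian field and the field of the first action are combinations of the
  independent fields of \<open>J\<close>. Solving for the frequencies and dividing gives the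
  formula; the two inequalities make the first frequency finite and nonzero.\<close>

lemma rotation_number_eq:
  assumes l: "exp l \<in> ball 0 r" and a: "dPhi1 (exp l) \<noteq> 0" and \<tau>: "\<sigma>\<^sub>1 (exp l) - Re l \<noteq> 0"
  shows "rotation_number \<A> \<Omega> N H J I\<^sub>1 l =
    (dPhi2 (exp l) / dPhi1 (exp l) * (\<sigma>\<^sub>1 (exp l) - Re l) - (\<sigma>\<^sub>2 (exp l) + Im l)) / (2 * pi)"
proof -
  define A B \<tau>1 \<tau>2 where "A = dPhi1 (exp l)" and "B = dPhi2 (exp l)"
    and "\<tau>1 = \<sigma>\<^sub>1 (exp l) - Re l" and "\<tau>2 = \<sigma>\<^sub>2 (exp l) + Im l"
  have [simp]: "A \<noteq> 0" "\<tau>1 \<noteq> 0" using a \<tau> by (auto simp: A_def \<tau>1_def)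
  have I1: "ham_vf \<Omega> (action_branch I\<^sub>1 J l) c p =
      (\<tau>1 / (2 * pi)) *\<^sub>R ham_vf \<Omega> (Re \<circ> J) c p + (\<tau>2 / (2 * pi)) *\<^sub>R ham_vf \<Omega> (Im \<circ> J) c p"
    if "c \<in> \<A>" "p \<in> N \<inter> fst c" "J p = exp l" for c p
  proof -
    have "ln_branch l (exp l) = l" by (simp add: ln_branch_def)
    moreover have "p \<in> fst c \<inter> slit_preimage N J l"
      using that by (auto simp: slit_preimage_def complex_nonpos_Reals_iff)
    ultimately have "(2 * pi) *\<^sub>R ham_vf \<Omega> (action_branch I\<^sub>1 J l) c p =
        \<tau>1 *\<^sub>R ham_vf \<Omega> (Re \<circ> J) c p + \<tau>2 *\<^sub>R ham_vf \<Omega> (Im \<circ> J) c p"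
      using I1_field[OF l that(1) _ that(3)[symmetric]] by (simp add: \<tau>1_def \<tau>2_def)
    from arg_cong[OF this, of "\<lambda>u. (1 / (2 * pi)) *\<^sub>R u"] show ?thesis
      by (simp add: scaleR_add_right)
  qed
  have H: "ham_vf \<Omega> H c p = A *\<^sub>R ham_vf \<Omega> (Re \<circ> J) c p + B *\<^sub>R ham_vf \<Omega> (Im \<circ> J) c p"
    if "c \<in> \<A>" "p \<in> N \<inter> fst c" "J p = exp l" for c p
    using ham_vf_H[OF that(1,2)] that(3) by (simp add: A_def B_def)
  have "rotation_number \<A> \<Omega> N H J I\<^sub>1 l = (B / A * \<tau>1 - \<tau>2) / (2 * pi)"
    unfolding rotation_number_def
  proof (rule the_equality)
    \<comment> \<open>The frequencies: the first matches the coefficient along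
      \<open>Re \<circ> J\<close>, the second is what remains along
      \<open>Im \<circ> J\<close>.\<close>
    let ?o1 = "2 * pi * A / \<tau>1" and ?o2 = "B - A * \<tau>2 / \<tau>1"
    have "(B / A * \<tau>1 - \<tau>2) / (2 * pi) = ?o2 / ?o1" by (simp add: field_simps)
    moreover have "ham_vf \<Omega> H c p = ?o1 *\<^sub>R ham_vf \<Omega> (action_branch I\<^sub>1 J l) c p + ?o2 *\<^sub>R ham_vf \<Omega> (Im \<circ> J) c p"
      if "c \<in> \<A>" "p \<in> N \<inter> fst c" "J p = exp l" for c p
      by (simp add: I1[OF that] H[OF that] scaleR_add_right scaleR_diff_left)
    ultimately show "\<exists>\<omega>\<^sub>1 \<omega>\<^sub>2. (B / A * \<tau>1 - \<tau>2) / (2 * pi) = \<omega>\<^sub>2 / \<omega>\<^sub>1 \<and>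
        (\<forall>c\<in>\<A>. \<forall>p\<in>N \<inter> fst c. J p = exp l \<longrightarrow> ham_vf \<Omega> H c p =
          \<omega>\<^sub>1 *\<^sub>R ham_vf \<Omega> (action_branch I\<^sub>1 J l) c p + \<omega>\<^sub>2 *\<^sub>R ham_vf \<Omega> (Im \<circ> J) c p)"
      by blast
  next
    fix w
    assume "\<exists>\<omega>\<^sub>1 \<omega>\<^sub>2. w = \<omega>\<^sub>2 / \<omega>\<^sub>1 \<and>
        (\<forall>c\<in>\<A>. \<forall>p\<in>N \<inter> fst c. J p = exp l \<longrightarrow> ham_vf \<Omega> H c p =
          \<omega>\<^sub>1 *\<^sub>R ham_vf \<Omega> (action_branch I\<^sub>1 J l) c p + \<omega>\<^sub>2 *\<^sub>R ham_vf \<Omega> (Im \<circ> J) c p)"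
    then obtain o1 o2 where w: "w = o2 / o1"
      and *: "\<And>c p. c \<in> \<A> \<Longrightarrow> p \<in> N \<inter> fst c \<Longrightarrow> J p = exp l \<Longrightarrow> ham_vf \<Omega> H c p =
          o1 *\<^sub>R ham_vf \<Omega> (action_branch I\<^sub>1 J l) c p + o2 *\<^sub>R ham_vf \<Omega> (Im \<circ> J) c p"
      by blast
    \<comment> \<open>Uniqueness is tested at a single point of the fibre, in any chart around
      it.\<close>
    obtain p where p: "p \<in> N" "J p = exp l" using fibre_nonempty[of "exp l"] l by auto
    obtain c where c: "c \<in> \<A>" "p \<in> N \<inter> fst c" using cover p by blast
    have "(A - o1 * \<tau>1 / (2 * pi)) *\<^sub>R ham_vf \<Omega> (Re \<circ> J) c p
        + (B - o1 * \<tau>2 / (2 * pi) - o2) *\<^sub>R ham_vf \<Omega> (Im \<circ> J) c p = 0"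
      using *[OF c p(2)] unfolding I1[OF c p(2)] H[OF c p(2)]
      by (simp add: scaleR_add_right scaleR_add_left scaleR_diff_left algebra_simps)
    moreover have "J p \<noteq> 0" using p(2) by simp
    ultimately have "A - o1 * \<tau>1 / (2 * pi) = 0" "B - o1 * \<tau>2 / (2 * pi) - o2 = 0"
      using ham_vf_J_independent[OF c] by blast+
    then have A: "A = o1 * \<tau>1 / (2 * pi)" and B: "B = o1 * \<tau>2 / (2 * pi) + o2" by auto
    have "o1 \<noteq> 0" using A \<open>A \<noteq> 0\<close> by auto
    then show "w = (B / A * \<tau>1 - \<tau>2) / (2 * pi)"
      unfolding w A B by (simp add: field_simps)
  qed
  then show ?thesis by (simp add: A_def B_def \<tau>1_def \<tau>2_def)
qed

end

section \<open>Choice of the disc and assembly\<close>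

theorem theorem3:
  fixes \<A> :: "'m::{t2_space, second_countable_topology} chart set"
    and \<Omega> :: "'m chart \<Rightarrow> 'm \<Rightarrow> real^4 \<Rightarrow> real^4 \<Rightarrow> real"
    and H L :: "'m \<Rightarrow> real" and m :: 'm and \<alpha> \<omega> :: real
    and c\<^sub>0 :: "'m chart" and \<Phi> \<Psi> :: "complex \<Rightarrow> real" and r :: real and N :: "'m set"
    and I\<^sub>1 \<sigma>\<^sub>1 \<sigma>\<^sub>2 :: "complex \<Rightarrow> real"
    and lam :: complex and W :: "complex \<Rightarrow> real"
  assumes "focus_focus_actions \<A> \<Omega> H L m \<alpha> \<omega> c\<^sub>0 \<Phi> \<Psi> r N I\<^sub>1 \<sigma>\<^sub>1 \<sigma>\<^sub>2"
  defines "lam \<equiv> Complex \<alpha> \<omega>"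
    and "W \<equiv> rotation_number \<A> \<Omega> N H (ext_J \<Phi> \<Psi> r H L) I\<^sub>1"
  shows "\<exists>U V G G'. 0 \<in> U \<and> U \<subseteq> ball 0 r \<and> G 0 = 0 \<and>
    Ck_diffeo 1 U V G G' \<and> smooth_diffeo (U - {0}) (V - {0}) G G' \<and>
    (\<forall>p\<in>U - {0}. G ` level_set W (U - {0}) p =
      integral_curve (\<lambda>\<zeta>. - cnj lam * \<zeta>) (V - {0}) (G p)) \<and>
    (\<forall>q\<in>V - {0}. integral_curve (\<lambda>\<zeta>. - cnj lam * \<zeta>) (V - {0}) q =
      {exp (- cnj lam * of_real t) * q | t. exp (- cnj lam * of_real t) * q \<in> V}) \<and>
    (\<forall>p\<in>U - {0}. is_spiral (level_set W (U - {0}) p))"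
proof -
  interpret focus_focus_actions \<A> \<Omega> H L m \<alpha> \<omega> c\<^sub>0 \<Phi> \<Psi> r N I\<^sub>1 \<sigma>\<^sub>1 \<sigma>\<^sub>2 by fact
  have dPhi: "Ck_on k (ball 0 r) (\<lambda>j. frechet_derivative \<Phi> (at j) v)" for k v
    by (rule Ck_on_SucD(2)[OF smooth_onD[OF Phi_smooth]])
  \<comment> \<open>The first partial derivative of \<Phi> is \<alpha> at the origin, so it can be
    divided by on a small disc.\<close>
  have "isCont dPhi1 0"
    using dPhi[of 0 1] r_pos by (simp add: continuous_on_eq_continuous_at)
  then have "\<forall>\<^sub>F j in nhds 0. dPhi1 j \<noteq> 0"
    using Phi_deriv(1) nonzero(1)
    by (intro tendsto_imp_eventually_ne[of _ \<alpha>]) (simp_all add: continuous_at tendsto_nhds_iff isCont_def)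
  then obtain R0 where R0: "R0 > 0" "\<And>j. dist j 0 < R0 \<Longrightarrow> dPhi1 j \<noteq> 0"
    unfolding eventually_nhds_metric by blast
  define R where "R = min R0 r"
  have R: "0 < R" "R \<le> r" and a: "\<And>j. j \<in> ball 0 R \<Longrightarrow> dPhi1 j \<noteq> 0"
    using R0 r_pos by (auto simp: R_def)
  define h where "h = (\<lambda>j. dPhi2 j / dPhi1 j)"
  have sub: "ball 0 R \<subseteq> ball (0::complex) r" using R by (simp add: subset_ball)
  have h: "Ck_on k (ball 0 R) h" for k
    unfolding h_def by (intro Ck_on_divide Ck_on_subset[OF dPhi sub] a) auto
  have \<sigma>: "Ck_on k (ball 0 R) \<sigma>\<^sub>1" "Ck_on k (ball 0 R) \<sigma>\<^sub>2" for k
    using Ck_on_subset[OF smooth_onD sub] sigma_smooth by auto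
  interpret tw: twist "\<lambda>j. h j - \<omega> / \<alpha>" "\<lambda>j. \<sigma>\<^sub>2 j - h j * \<sigma>\<^sub>1 j" R
  proof
    show "smooth_on (ball 0 R) (\<lambda>j. h j - \<omega> / \<alpha>)"
      unfolding smooth_on_def by (intro allI Ck_on_diff h Ck_on_const open_ball)
    show "smooth_on (ball 0 R) (\<lambda>j. \<sigma>\<^sub>2 j - h j * \<sigma>\<^sub>1 j)"
      unfolding smooth_on_def by (intro allI Ck_on_diff Ck_on_mult h \<sigma> open_ball)
  qed (use R Phi_deriv in \<open>auto simp: h_def\<close>)
  have "isCont \<sigma>\<^sub>1 0"
    using \<sigma>(1)[of 0] R by (simp add: continuous_on_eq_continuous_at)
  then have "\<forall>\<^sub>F j in nhds 0. \<sigma>\<^sub>1 0 - 1 < \<sigma>\<^sub>1 j"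
    by (intro order_tendstoD[of _ "\<sigma>\<^sub>1 0"]) (simp_all add: continuous_at tendsto_nhds_iff isCont_def)
  then obtain e0 where e0: "e0 > 0" "\<And>j. dist j 0 < e0 \<Longrightarrow> \<sigma>\<^sub>1 0 - 1 < \<sigma>\<^sub>1 j"
    unfolding eventually_nhds_metric by blast
  \<comment> \<open>Near the origin \<open>\<sigma>\<^sub>1\<close> exceeds its value there minus 1,
    and the bound on the modulus puts Re l below that same number; hence the difference is
    positive.\<close>
  have \<tau>: "\<sigma>\<^sub>1 (exp l) - Re l \<noteq> 0" if "norm (exp l) < min e0 (exp (\<sigma>\<^sub>1 0 - 1))" for l :: complex
    using that e0(2)[of "exp l"] by simp
  obtain d G' where d: "0 < d" "d < min e0 (exp (\<sigma>\<^sub>1 0 - 1))" "d \<le> R"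
    and diff1: "Ck_diffeo 1 (ball 0 d) (ball 0 d) tw.G G'"
    and diff: "smooth_diffeo (ball 0 d - {0}) (ball 0 d - {0}) tw.G G'"
    using tw.twist_diffeo[of "min e0 (exp (\<sigma>\<^sub>1 0 - 1))"] e0(1) by auto
  \<comment> \<open>The factor -1/(2\<pi>\<alpha>) is the -1/(2\<pi>) in the formula for
    \<open>W\<close>, with the common denominator \<alpha> taken out.\<close>
  interpret lev: twisted_levels tw.phi tw.G G' W \<alpha> \<omega> "- 1 / (2 * pi * \<alpha>)" d
  proof
    show "homeomorphism (ball 0 d) (ball 0 d) tw.G G'" using diff1 by (simp add: Ck_diffeo_def)
    show "continuous_on (ball 0 d) tw.phi"
      using tw.phi_cont d by (auto intro: continuous_on_subset)
    show "W l = - 1 / (2 * pi * \<alpha>) * (\<omega> * Re l + \<alpha> * Im l + \<alpha> * tw.phi (exp l))"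
      if "exp l \<in> ball 0 d" for l
    proof -
      have l: "exp l \<in> ball 0 R" "norm (exp l) < min e0 (exp (\<sigma>\<^sub>1 0 - 1))"
        using that d(3) less_trans[OF _ d(2), of "norm (exp l)"] by (auto simp del: norm_exp_eq_Re)
      have "W l = (h (exp l) * (\<sigma>\<^sub>1 (exp l) - Re l) - (\<sigma>\<^sub>2 (exp l) + Im l)) / (2 * pi)"
        unfolding W_def h_def using sub l(1) by (intro rotation_number_eq a l \<tau>) blast
      moreover have "tw.phi (exp l) = (h (exp l) - \<omega> / \<alpha>) * Re l + (\<sigma>\<^sub>2 (exp l) - h (exp l) * \<sigma>\<^sub>1 (exp l))"
        by (simp add: tw.phi_def)
      ultimately show ?thesis
        using nonzero by (simp only:) (simp add: field_simps)
    qed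
  qed (use d nonzero in \<open>auto simp: tw.G_def\<close>)
  have lam: "- cnj lam = lev.a" by (simp add: lam_def)
  have curve: "integral_curve (\<lambda>\<zeta>. - cnj lam * \<zeta>) (ball 0 d - {0}) q =
      {exp (- cnj lam * of_real t) * q | t. exp (- cnj lam * of_real t) * q \<in> ball 0 d}"
    if "q \<in> ball 0 d - {0}" for q
    using that by (rule integral_curve_disc)
  have GD: "tw.G p \<in> ball 0 d - {0}" if "p \<in> ball 0 d - {0}" for p
  proof -
    have "0 < norm (tw.G p)" "norm (tw.G p) < d"
      unfolding tw.norm_G using that by simp_all
    then show ?thesis by (simp del: tw.norm_G)
  qed
  show ?thesis
  \<comment> \<open>\<open>U\<close> and \<open>V\<close> are the same disc of radius
    \<open>d\<close>, which \<open>tw.G\<close> maps onto itself.\<close>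
  proof (intro exI conjI ballI)
    show "tw.G ` level_set W (ball 0 d - {0}) p = integral_curve (\<lambda>\<zeta>. - cnj lam * \<zeta>) (ball 0 d - {0}) (tw.G p)"
      if "p \<in> ball 0 d - {0}" for p
      by (rule trans[OF lev.level_set_eq[OF that, folded lam] curve[OF GD[OF that], symmetric]])
    show "integral_curve (\<lambda>\<zeta>. - cnj lam * \<zeta>) (ball 0 d - {0}) q =
        {exp (- cnj lam * of_real t) * q | t. exp (- cnj lam * of_real t) * q \<in> ball 0 d}"
      if "q \<in> ball 0 d - {0}" for q
      using that by (rule curve)
    show "is_spiral (level_set W (ball 0 d - {0}) p)" if "p \<in> ball 0 d - {0}" for p
      using that by (rule lev.is_spiral_level_set)
    show "ball 0 d \<subseteq> ball (0::complex) r" using d R by (simp add: subset_ball)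
  qed (use d diff1 diff in \<open>simp_all add: tw.G_def\<close>)
qed

end
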